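(* Let $n>2$ be an integer and $s\in\mathbb{R}$ with $s\ne-\frac n2-k$ for all $k=0,1,2,\dots$. If $n$ is odd, suppose in addition that $s+n-1\ge0$; if $n$ is even, no additional assumption is made. Then $$\lim_{m\to\infty}m^{s+1}I_m(s)=\frac{\Gamma(\frac n2)\,\Gamma(s+2n-1)\,\Gamma(1+\frac{s+n}{2})\,\Gamma(s+\frac n2+1)\,\Gamma(\frac{s+n}{2})}{\Gamma(n-1)^2\,\Gamma(s+n+1)\,\Gamma(n+\frac s2)\,\Gamma(1+\frac s2)}.$$
   Context: The function $1/\Gamma$ is taken to be $0$ at non-positive integers. $(a)_\ell=a(a+1)\cdots(a+\ell-1)$ is the Pochhammer symbol, $(a)_0=1$, and ${}_2F_1$ is the Gauss hypergeometric function. For integers $n>2$ and $m\ge0$ put $$S_m(t)=\frac{(n-1)_m}{(\frac n2)_m}\,{}_2F_1\!\left(\begin{matrix}m,\ 1-\frac n2\\ m+\frac n2\end{matrix};t\right),$$ and for $s>-1$ (or $\operatorname{Re}s>-1$) $$I_m(s)=\frac{\Gamma(\frac n2+s+1)}{\Gamma(\frac n2)\,\Gamma(s+1)}\int_0^1t^{m+\frac n2-1}(1-t)^sS_m(t)^2\,dt.$$ The function $I_m$ extends to a meromorphic function on $\mathbb{C}$, still denoted $I_m(s)$; for $s\le-1$, $I_m(s)$ means the value of this continuation. *)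

theory Defs
  imports "HOL-Complex_Analysis.Complex_Analysis"
begin

definition hyp2F1 :: "real \<Rightarrow> real \<Rightarrow> real \<Rightarrow> real \<Rightarrow> real" where
  "hyp2F1 a b c t = eval_fps (fps_hypergeo [a, b] [c] 1) t"

lemma hyp2F1_altdef:
  "hyp2F1 a b c t =
     (\<Sum>k. pochhammer a k * pochhammer b k / (pochhammer c k * fact k) * t ^ k)"
  by (simp add: hyp2F1_def eval_fps_def fps_hypergeo_nth)

definition S :: "nat \<Rightarrow> nat \<Rightarrow> real \<Rightarrow> real" where
  "S n m t = pochhammer (real n - 1) m / pochhammer (real n / 2) m *
     hyp2F1 (real m) (1 - real n / 2) (real m + real n / 2) t"

text \<open>The integral formula, meaningful for \<open>Re s > -1\<close> only.\<close>

definition I_integral :: "nat \<Rightarrow> nat \<Rightarrow> complex \<Rightarrow> complex" where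
  "I_integral n m s =
     Gamma (of_nat n / 2 + s + 1) / (Gamma (of_nat n / 2) * Gamma (s + 1)) *
     integral {0..1} (\<lambda>t::real.
       of_real (t powr (real m + real n / 2 - 1)) * of_real (1 - t) powr s * of_real (S n m t ^ 2))"

text \<open>
  The meromorphic continuation of the integral formula to the whole plane.
  \<^const>\<open>meromorphic_on\<close> leaves the values on a discrete set arbitrary. Requiring
  \<^const>\<open>nicely_meromorphic_on\<close> removes this freedom (removable singularities are filled in
  and poles get the value 0), so that the continuation is unique as a function.
\<close>

definition I :: "nat \<Rightarrow> nat \<Rightarrow> complex \<Rightarrow> complex" where
  "I n m = (THE f. f nicely_meromorphic_on UNIV \<and> (\<forall>s. Re s > -1 \<longrightarrow> f s = I_integral n m s))"

end

(*
  Put p = n/2 - 1 and F(t) = 2F1(m, -p; m + p + 1; t), a constant multiple of S_m. Integration by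
  parts with the hypergeometric equation gives a four-term recurrence in s for the moments M_m(s) of
  F^2 against t^(m+p) (1 - t)^s. In terms of M_m(s) / Gamma(s + 1) its leading coefficient is
  (s + n)(s + 2n - 1), so this quotient continues to the complement of the integers <= -n. As
  m -> oo the recurrence, scaled by m^(s+1), degenerates into a two-step recurrence which the
  asserted limit L also satisfies. Hence for large s the ratio r_m(s) of the scaled moment to L(s)
  satisfies r_m(s) - r_m(s + 2k) -> 0 for every fixed k. Euler's integral yields
  (1 - t)^p <= F(t) <= sum_i c_i (1 - t)^(p - i) with c_i = O(m^(-i)), and the resulting Beta
  integrals squeeze r_m(s + 2k) towards 1 as first m and then k tend to infinity. The recurrence
  then carries the limit down to all remaining s.
*)

theory Submission
  imports Defs "HOL-Real_Asymp.Real_Asymp"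
begin

section \<open>Ratios of Gamma values\<close>

text \<open>The limiting two-step recurrence determines the limit only up to a factor of period 2 in
  s, so it has to be anchored somewhere, and the anchor lies at s -> oo. There the weight t^(m+p) (1
  - t)^s concentrates where 1 - t is of size s/m, while F(t) differs from (1 - t)^p by a relative
  error of order 1/(m (1 - t)), that is 1/s. Hence the two bounds, whose limits in m differ for each
  fixed s, share their leading order in s. The recurrence arises by elimination from integrations by
  parts of F^2, F U and U^2, where U = t F'. Its leading coefficient for the bare moments has the
  extra zero s = -1; division by Gamma(s + 1) absorbs it, so the first obstruction to continuation
  moves from -1 to -n. This explains the case distinction in the theorem: for even n the integers <=
  -n are among the excluded -n/2 - k, for odd n the bound s >= 1 - n avoids them.\<close>

lemma Gamma_add_nat_asymp:
  fixes a :: real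
  assumes "a > 0"
  shows "(\<lambda>N. Gamma (a + real N) / (fact (N - 1) * real N powr a)) \<longlonglongrightarrow> 1"
proof -
  have nz: "a \<notin> \<int>\<^sub>\<le>\<^sub>0" using assms by (auto elim!: nonpos_Ints_cases)
  have G: "Gamma a > 0" using assms by (rule Gamma_real_pos)
  \<comment> \<open>\<open>Gamma_series' a N\<close> is
    \<open>fact (N - 1) * N powr a / pochhammer a N\<close>, and
    \<open>pochhammer a N * Gamma a\<close> is \<open>Gamma (a + N)\<close>. The claim is its
    convergence to \<open>Gamma a\<close>, inverted; the factorial cancels later in quotients with a
    second argument.\<close>
  have "(\<lambda>N. Gamma a / Gamma_series' a N) \<longlonglongrightarrow> Gamma a / Gamma a"
    using G by (intro tendsto_divide tendsto_const Gamma_series'_LIMSEQ) auto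
  moreover have "\<forall>\<^sub>F N in sequentially. Gamma a / Gamma_series' a N = Gamma (a + real N) / (fact (N - 1) * real N powr a)"
    using eventually_gt_at_top[of 0]
  proof eventually_elim
    case (elim N)
    have "pochhammer a N * Gamma a = Gamma (a + real N)"
      using pochhammer_Gamma[OF nz, of N] G by simp
    then show ?case using elim assms
      by (simp add: Gamma_series'_def powr_def mult_ac)
  qed
  ultimately show ?thesis using G by (simp add: filterlim_cong[OF refl refl])
qed

lemma Gamma_ratio_asymp:
  fixes a b :: real
  assumes "a > 0" "b > 0"
  shows "(\<lambda>N. Gamma (a + real N) / Gamma (b + real N) * real N powr (b - a)) \<longlonglongrightarrow> 1"
proof -
  have "(\<lambda>N. (Gamma (a + real N) / (fact (N - 1) * real N powr a)) / (Gamma (b + real N) / (fact (N - 1) * real N powr b)))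
     \<longlonglongrightarrow> 1 / 1"
    by (intro tendsto_divide Gamma_add_nat_asymp assms) auto
  moreover have "\<forall>\<^sub>F N in sequentially. (Gamma (a + real N) / (fact (N - 1) * real N powr a)) / (Gamma (b + real N) / (fact (N - 1) * real N powr b))
      = Gamma (a + real N) / Gamma (b + real N) * real N powr (b - a)"
    using eventually_gt_at_top[of 0]
    by eventually_elim (simp add: powr_diff)
  ultimately show ?thesis by (simp add: filterlim_cong[OF refl refl])
qed

text \<open>Serves the Gamma arguments in s, which move by 2 when s does; those in s/2 move by
  1.\<close>

lemma Gamma_ratio_asymp_even:
  fixes a b :: real
  assumes "a > 0" "b > 0"
  shows "(\<lambda>N. Gamma (a + 2 * real N) / Gamma (b + 2 * real N) * (2 * real N) powr (b - a)) \<longlonglongrightarrow> 1"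
proof -
  have "filterlim (\<lambda>N::nat. 2 * N) sequentially sequentially"
    by (intro filterlim_subseq) (auto simp: strict_mono_def)
  from filterlim_compose[OF Gamma_ratio_asymp[OF assms] this] show ?thesis by simp
qed

section \<open>The hypergeometric series\<close>

definition hyp_coeff :: "real \<Rightarrow> real \<Rightarrow> real \<Rightarrow> nat \<Rightarrow> real" where
  "hyp_coeff a b c k = pochhammer a k * pochhammer b k / (pochhammer c k * fact k)"

lemma hyp2F1_eq_powser: "hyp2F1 a b c t = (\<Sum>k. hyp_coeff a b c k * t ^ k)"
  by (simp add: hyp2F1_altdef hyp_coeff_def)

lemma hyp_coeff_Suc:
  assumes "c > 0"
  shows "(real k + 1) * (c + real k) * hyp_coeff a b c (Suc k) = (a + real k) * (b + real k) * hyp_coeff a b c k"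
proof -
  have "pochhammer c k > 0" using assms by (intro pochhammer_pos)
  then show ?thesis using assms
    by (simp add: hyp_coeff_def pochhammer_Suc divide_simps add_eq_0_iff)
qed

text \<open>Consecutive coefficients have the ratio (a + k)(b + k) / ((c + k)(1 + k)). Since a <= c
  and b <= 1, this lies in [0, 1] as soon as b + k >= 0, so the maximum over the finitely many
  earlier indices is a bound.\<close>

lemma hyp_coeff_bounded:
  assumes "0 < a" "a \<le> c" "b \<le> 1"
  obtains C where "C > 0" "\<And>k. \<bar>hyp_coeff a b c k\<bar> \<le> C"
proof -
  define K where "K = nat \<lceil>-b\<rceil>"
  define C where "C = Max ((\<lambda>k. \<bar>hyp_coeff a b c k\<bar>) ` {..K})"
  have le: "\<bar>hyp_coeff a b c k\<bar> \<le> C" if "k \<le> K" for k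
    unfolding C_def using that by (intro Max_ge) auto
  have step: "\<bar>hyp_coeff a b c (Suc k)\<bar> \<le> \<bar>hyp_coeff a b c k\<bar>" if "K \<le> k" for k
  proof -
    have bk: "0 \<le> b + real k" using that unfolding K_def by linarith
    have pos: "(real k + 1) * (c + real k) > 0" using assms by (intro mult_pos_pos) auto
    have "(real k + 1) * (c + real k) * \<bar>hyp_coeff a b c (Suc k)\<bar>
        = \<bar>(real k + 1) * (c + real k) * hyp_coeff a b c (Suc k)\<bar>"
      using abs_of_pos[OF pos] by (simp only: abs_mult)
    also have "\<dots> = (a + real k) * (b + real k) * \<bar>hyp_coeff a b c k\<bar>"
      using assms bk by (subst hyp_coeff_Suc) (auto simp: abs_mult)
    also have "\<dots> \<le> (c + real k) * (real k + 1) * \<bar>hyp_coeff a b c k\<bar>"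
      using assms bk by (intro mult_right_mono mult_mono) auto
    finally have "(real k + 1) * (c + real k) * \<bar>hyp_coeff a b c (Suc k)\<bar>
        \<le> (real k + 1) * (c + real k) * \<bar>hyp_coeff a b c k\<bar>" by (simp only: mult_ac)
    then show ?thesis using pos by (metis mult_le_cancel_left_pos)
  qed
  have "\<bar>hyp_coeff a b c k\<bar> \<le> C" for k
  proof (cases "k \<le> K")
    case False
    then have "K \<le> k" by simp
    then show ?thesis by (induction rule: dec_induct) (use le step in \<open>auto intro: order_trans\<close>)
  qed (rule le)
  moreover have "C > 0"
    using le[of 0] by (simp add: hyp_coeff_def)
  ultimately show ?thesis using that by blast
qed

lemma bounded_coeff_summable:
  fixes c :: "nat \<Rightarrow> real"
  assumes "\<And>k. \<bar>c k\<bar> \<le> C" "\<bar>t\<bar> < 1"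
  shows "summable (\<lambda>k. c k * t ^ k)"
proof (rule summable_comparison_test')
  show "summable (\<lambda>k. C * \<bar>t\<bar> ^ k)" using assms by (intro summable_mult summable_geometric) auto
  show "norm (c k * t ^ k) \<le> C * \<bar>t\<bar> ^ k" if "k \<ge> 0" for k
    using assms by (auto simp: abs_mult power_abs intro: mult_right_mono)
qed

text \<open>The operator t d/dt multiplies the k-th coefficient by k without shifting the index.
  Using it in place of d/dt keeps the hypergeometric equation close to the recursion of the
  coefficients.\<close>

lemma powser_euler_deriv:
  fixes c :: "nat \<Rightarrow> real"
  assumes "\<And>t. \<bar>t\<bar> < 1 \<Longrightarrow> summable (\<lambda>k. c k * t ^ k)" "\<bar>t\<bar> < 1"
  shows "summable (\<lambda>k. (real k * c k) * t ^ k)"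
    and "t \<noteq> 0 \<Longrightarrow> ((\<lambda>t. \<Sum>k. c k * t ^ k) has_real_derivative (\<Sum>k. (real k * c k) * t ^ k) / t) (at t)"
proof -
  obtain K where K: "\<bar>t\<bar> < K" "K < 1" using assms(2) dense by blast
  have sd: "summable (\<lambda>k. diffs c k * t ^ k)"
    by (rule termdiff_converges[of t 1]) (use assms in auto)
  have "(\<lambda>k. real k * c k * t ^ (k - Suc 0)) sums (\<Sum>k. diffs c k * t ^ k)"
    using diffs_equiv[OF sd] by simp
  then have "(\<lambda>k. t * (real k * c k * t ^ (k - Suc 0))) sums (t * (\<Sum>k. diffs c k * t ^ k))"
    by (rule sums_mult)
  moreover have "t * (real k * c k * t ^ (k - Suc 0)) = (real k * c k) * t ^ k" for k
    by (cases k) auto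
  ultimately have s: "(\<lambda>k. (real k * c k) * t ^ k) sums (t * (\<Sum>k. diffs c k * t ^ k))" by simp
  then show "summable (\<lambda>k. (real k * c k) * t ^ k)" by (rule sums_summable)
  have "((\<lambda>t. \<Sum>k. c k * t ^ k) has_real_derivative (\<Sum>k. diffs c k * t ^ k)) (at t)"
    by (rule termdiffs_strong[of _ K]) (use assms K in auto)
  then show "((\<lambda>t. \<Sum>k. c k * t ^ k) has_real_derivative (\<Sum>k. (real k * c k) * t ^ k) / t) (at t)" if "t \<noteq> 0"
    using sums_unique[OF s, symmetric] that by simp
qed

text \<open>The Euler derivative t d/dt of \<open>hyp2F1\<close>.\<close>

definition theta_hyp2F1 :: "real \<Rightarrow> real \<Rightarrow> real \<Rightarrow> real \<Rightarrow> real" where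
  "theta_hyp2F1 a b c t = (\<Sum>k. (real k * hyp_coeff a b c k) * t ^ k)"

context
  fixes a b c :: real
  assumes abc: "0 < a" "a \<le> c" "b \<le> 1"
begin

lemma hyp_coeff_summable: "\<bar>t\<bar> < 1 \<Longrightarrow> summable (\<lambda>k. hyp_coeff a b c k * t ^ k)"
  using hyp_coeff_bounded[OF abc] bounded_coeff_summable by metis

lemma isCont_hyp2F1:
  assumes "\<bar>t\<bar> < 1"
  shows "isCont (hyp2F1 a b c) t"
proof -
  obtain K where K: "\<bar>t\<bar> < K" "K < 1" using assms dense by blast
  have e: "hyp2F1 a b c = (\<lambda>t. \<Sum>k. hyp_coeff a b c k * t ^ k)" using hyp2F1_eq_powser by blast
  show ?thesis unfolding e
    by (rule isCont_powser[of _ K]) (use K hyp_coeff_summable[of K] in auto)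
qed

lemma DERIV_hyp2F1:
  assumes "0 < t" "t < 1"
  shows "(hyp2F1 a b c has_real_derivative theta_hyp2F1 a b c t / t) (at t)"
proof -
  have e: "hyp2F1 a b c = (\<lambda>t. \<Sum>k. hyp_coeff a b c k * t ^ k)" using hyp2F1_eq_powser by blast
  show ?thesis unfolding e theta_hyp2F1_def
    by (rule powser_euler_deriv(2)) (use assms hyp_coeff_summable in auto)
qed

text \<open>With theta = t d/dt the recursion of the coefficients reads theta (theta + c - 1) F = t
  (theta + a)(theta + b) F. Here v is theta^2 F, and the second conclusion is this equation solved
  for (1 - t) v.\<close>

lemma DERIV_theta_hyp2F1:
  assumes "0 < t" "t < 1"
  obtains v where "(theta_hyp2F1 a b c has_real_derivative v / t) (at t)"
    "(1 - t) * v = - (c - 1) * theta_hyp2F1 a b c t + t * (a + b) * theta_hyp2F1 a b c t + a * b * t * hyp2F1 a b c t"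
proof -
  let ?u = "hyp_coeff a b c"
  define v where "v = (\<Sum>k. (real k * (real k * ?u k)) * t ^ k)"
  have t: "\<bar>t\<bar> < 1" using assms by auto
  have e: "theta_hyp2F1 a b c = (\<lambda>t. \<Sum>k. (real k * ?u k) * t ^ k)"
    using theta_hyp2F1_def by blast
  have s1: "summable (\<lambda>k. (real k * ?u k) * t ^ k)" if "\<bar>t\<bar> < 1" for t
    by (rule powser_euler_deriv(1)) (use hyp_coeff_summable that in auto)
  have d: "(theta_hyp2F1 a b c has_real_derivative v / t) (at t)"
    unfolding e v_def by (rule powser_euler_deriv(2)) (use s1 t assms in auto)
  have s2: "summable (\<lambda>k. (real k * (real k * ?u k)) * t ^ k)"
    by (rule powser_euler_deriv(1)) (use s1 t in auto)
  have S0: "(\<lambda>k. ?u k * t ^ k) sums hyp2F1 a b c t"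
    using hyp_coeff_summable[OF t] by (simp add: hyp2F1_eq_powser summable_sums)
  have S1: "(\<lambda>k. (real k * ?u k) * t ^ k) sums theta_hyp2F1 a b c t"
    using s1[OF t] by (simp add: theta_hyp2F1_def summable_sums)
  have S2: "(\<lambda>k. (real k * (real k * ?u k)) * t ^ k) sums v"
    using s2 by (simp add: v_def summable_sums)
  let ?L = "\<lambda>k. (real k * (real k * ?u k)) * t ^ k + (c - 1) * ((real k * ?u k) * t ^ k)"
  have L: "?L sums (v + (c - 1) * theta_hyp2F1 a b c t)"
    by (intro sums_add sums_mult S1 S2)
  have "(\<lambda>k. t * ((real k * (real k * ?u k)) * t ^ k + (a + b) * ((real k * ?u k) * t ^ k)
      + a * b * (?u k * t ^ k))) sums
      (t * (v + (a + b) * theta_hyp2F1 a b c t + a * b * hyp2F1 a b c t))"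
    by (intro sums_add sums_mult S0 S1 S2)
  moreover have "t * ((real k * (real k * ?u k)) * t ^ k + (a + b) * ((real k * ?u k) * t ^ k)
      + a * b * (?u k * t ^ k)) = ?L (Suc k)" for k
  proof -
    have "c > 0" using abc by simp
    have "t * ((real k * (real k * ?u k)) * t ^ k + (a + b) * ((real k * ?u k) * t ^ k)
      + a * b * (?u k * t ^ k)) = ((a + real k) * (b + real k) * ?u k) * t ^ Suc k"
      by (simp add: algebra_simps)
    also have "\<dots> = ?L (Suc k)"
      unfolding hyp_coeff_Suc[OF \<open>c > 0\<close>, symmetric] by (simp add: algebra_simps)
    finally show ?thesis .
  qed
  ultimately have "(\<lambda>k. ?L (Suc k)) sums
      (t * (v + (a + b) * theta_hyp2F1 a b c t + a * b * hyp2F1 a b c t))" by simp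
  \<comment> \<open>The index shift leaves no boundary term because \<open>?L 0 = 0\<close>.\<close>
  then have "?L sums (t * (v + (a + b) * theta_hyp2F1 a b c t + a * b * hyp2F1 a b c t))"
    by (subst (asm) sums_Suc_iff) simp
  then have "v + (c - 1) * theta_hyp2F1 a b c t
     = t * (v + (a + b) * theta_hyp2F1 a b c t + a * b * hyp2F1 a b c t)"
    using L sums_unique2 by blast
  then have "(1 - t) * v = - (c - 1) * theta_hyp2F1 a b c t + t * (a + b) * theta_hyp2F1 a b c t + a * b * t * hyp2F1 a b c t"
    by (simp add: algebra_simps)
  with d show ?thesis using that by blast
qed

text \<open>Crude comparison with the geometric series and its derivative. Any polynomial growth at
  t = 1 suffices to kill boundary terms for large s; the exponents 1 and 2 make products of two such
  functions O((1 - t)^(-4)), which is the source of the thresholds s > 4 below.\<close>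

lemma hyp2F1_theta_bounds:
  obtains C where "C > 0" "\<And>t. 0 \<le> t \<Longrightarrow> t < 1 \<Longrightarrow> \<bar>hyp2F1 a b c t\<bar> \<le> C / (1 - t)"
    "\<And>t. 0 \<le> t \<Longrightarrow> t < 1 \<Longrightarrow> \<bar>theta_hyp2F1 a b c t\<bar> \<le> C / (1 - t) ^ 2"
proof -
  obtain C where C: "C > 0" "\<And>k. \<bar>hyp_coeff a b c k\<bar> \<le> C" using hyp_coeff_bounded[OF abc] by blast
  have 1: "\<bar>hyp2F1 a b c t\<bar> \<le> C / (1 - t)" if t: "0 \<le> t" "t < 1" for t
  proof -
    have "(\<lambda>k. C * t ^ k) sums (C * (1 / (1 - t)))"
      using t by (intro sums_mult geometric_sums) auto
    moreover have "norm (hyp_coeff a b c k * t ^ k) \<le> C * t ^ k" for k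
      using C t by (auto simp: abs_mult power_abs intro!: mult_right_mono)
    ultimately have "norm (\<Sum>k. hyp_coeff a b c k * t ^ k) \<le> C * (1 / (1 - t))"
      by (metis (no_types, lifting) norm_suminf_le sums_iff)
    then show ?thesis by (simp add: hyp2F1_eq_powser)
  qed
  have 2: "\<bar>theta_hyp2F1 a b c t\<bar> \<le> C / (1 - t) ^ 2" if t: "0 \<le> t" "t < 1" for t
  proof -
    have "(\<lambda>k. C * (real (Suc k) * t ^ k)) sums (C * (1 / (1 - t) ^ 2))"
      using t by (intro sums_mult geometric_deriv_sums) auto
    moreover have "norm ((real k * hyp_coeff a b c k) * t ^ k) \<le> C * (real (Suc k) * t ^ k)" for k
    proof -
      have "real k * \<bar>hyp_coeff a b c k\<bar> \<le> real (Suc k) * C"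
        using C by (intro mult_mono) auto
      then have "real k * \<bar>hyp_coeff a b c k\<bar> * t ^ k \<le> real (Suc k) * C * t ^ k"
        using t by (intro mult_right_mono) auto
      then show ?thesis using t by (simp add: abs_mult power_abs mult_ac)
    qed
    ultimately have "norm (\<Sum>k. (real k * hyp_coeff a b c k) * t ^ k) \<le> C * (1 / (1 - t) ^ 2)"
      by (metis (no_types, lifting) norm_suminf_le sums_iff)
    then show ?thesis by (simp add: theta_hyp2F1_def)
  qed
  show ?thesis using that C(1) 1 2 by blast
qed

end

section \<open>Bounds from Euler's integral\<close>

lemma powr_minus_one_nat: "1 \<le> m \<Longrightarrow> 0 < x \<Longrightarrow> x powr (real m - 1) = (x::real) ^ (m - 1)"
  by (simp add: powr_realpow[symmetric] of_nat_diff)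

text \<open>The natural power keeps the integrand continuous at u = 0: for m = 1 it is 1 there,
  whereas \<open>0 powr 0 = 0\<close>. The two forms agree only on the open interval, hence the
  detour through it.\<close>

lemma has_integral_Beta_nat:
  fixes b :: real
  assumes "m \<ge> 1" "b > -1"
  shows "((\<lambda>u. u ^ (m - 1) * (1 - u) powr b) has_integral Beta (real m) (b + 1)) {0..1}"
proof -
  have "((\<lambda>u. u powr (real m - 1) * (1 - u) powr (b + 1 - 1)) has_integral Beta (real m) (b + 1)) {0<..<1}"
    using has_integral_Beta_real[of "real m" "b + 1"] assms by (simp add: has_integral_Icc_iff_Ioo)
  then have "((\<lambda>u. u ^ (m - 1) * (1 - u) powr b) has_integral Beta (real m) (b + 1)) {0<..<1}"
    by (rule has_integral_eq[rotated]) (use assms powr_minus_one_nat in auto)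
  then show ?thesis by (simp add: has_integral_Icc_iff_Ioo)
qed

lemma Beta_add_nat_left:
  fixes a b :: real
  assumes "a > 0" "b > 0"
  shows "Beta (a + real k) b = Beta a b * pochhammer a k / pochhammer (a + b) k"
proof -
  have nz: "a \<notin> \<int>\<^sub>\<le>\<^sub>0" "a + b \<notin> \<int>\<^sub>\<le>\<^sub>0" using assms by (auto elim!: nonpos_Ints_cases)
  have "Gamma (a + real k) = pochhammer a k * Gamma a"
    "Gamma (a + b + real k) = pochhammer (a + b) k * Gamma (a + b)"
    using pochhammer_Gamma[OF nz(1), of k] pochhammer_Gamma[OF nz(2), of k] nz
    by (simp_all add: Gamma_eq_zero_iff)
  then show ?thesis by (simp add: Beta_def ac_simps add.commute[of "real k"])
qed

lemma powr_one_minus_sums: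
  fixes p z :: real
  assumes "\<bar>z\<bar> < 1"
  shows "(\<lambda>k. pochhammer (-p) k / fact k * z ^ k) sums (1 - z) powr p"
proof -
  have "(\<lambda>k. (p gchoose k) * (-z) ^ k) sums (1 + (-z)) powr p"
    by (rule gen_binomial_real) (use assms in auto)
  moreover have "(p gchoose k) * (-z) ^ k = pochhammer (-p) k / fact k * z ^ k" for k
    by (simp add: gbinomial_pochhammer power_minus[of z])
  ultimately show ?thesis by simp
qed

text \<open>Expanding (1 - t u)^p in powers of t u and integrating termwise produces Beta values,
  whose ratios to the first one are the missing Pochhammer quotients. As t < 1 is fixed, C t^k
  dominates the series uniformly in u, so limit and integral commute.\<close>

lemma hyp2F1_Euler_integral:
  fixes p t :: real and m :: nat
  assumes "m \<ge> 1" "p > 0" "0 \<le> t" "t < 1"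
  shows "((\<lambda>u. u ^ (m - 1) * (1 - u) powr p * (1 - t * u) powr p) has_integral
     Beta (real m) (p + 1) * hyp2F1 (real m) (-p) (real m + p + 1) t) {0..1}"
proof -
  define w where "w k = pochhammer (-p) k / fact k" for k
  define F where "F N u = (u ^ (m - 1) * (1 - u) powr p) * (\<Sum>k<N. w k * (t * u) ^ k)" for N u
  define G where "G u = (u ^ (m - 1) * (1 - u) powr p) * (1 - t * u) powr p" for u
  have tu: "\<bar>t * u\<bar> < 1" "\<bar>t * u\<bar> \<le> t" if "u \<in> {0..1}" for u
  proof -
    have "t * u \<le> t" "t * u \<ge> 0" using assms that by (auto intro: mult_left_le)
    then show "\<bar>t * u\<bar> < 1" "\<bar>t * u\<bar> \<le> t" using assms by auto
  qed
  \<comment> \<open>The binomial series is the degenerate hypergeometric series with a = c, so the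
    bound on its coefficients is already available.\<close>
  have w: "w k = hyp_coeff 1 (-p) 1 k" for k
    by (simp add: w_def hyp_coeff_def flip: pochhammer_fact)
  obtain C where C: "\<And>k. \<bar>w k\<bar> \<le> C"
    using hyp_coeff_bounded[of 1 1 "-p"] assms unfolding w by auto
  have M: "summable (\<lambda>k. C * t ^ k)" using assms by (intro summable_mult summable_geometric) auto
  have "uniform_limit {0..1} (\<lambda>N u. \<Sum>k<N. w k * (t * u) ^ k) (\<lambda>u. \<Sum>k. w k * (t * u) ^ k) sequentially"
  proof (rule Weierstrass_m_test[OF _ M])
    fix k :: nat and u :: real assume u: "u \<in> {0..1}"
    show "norm (w k * (t * u) ^ k) \<le> C * t ^ k"
      unfolding norm_mult norm_power using tu[OF u] C[of k] assms
      by (intro mult_mono power_mono) auto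
  qed
  moreover have "(\<Sum>k. w k * (t * u) ^ k) = (1 - t * u) powr p" if "u \<in> {0..1}" for u
    using powr_one_minus_sums[OF tu(1)[OF that]] by (simp add: w_def sums_iff)
  ultimately have ul0: "uniform_limit {0..1} (\<lambda>N u. \<Sum>k<N. w k * (t * u) ^ k) (\<lambda>u. (1 - t * u) powr p) sequentially"
    by (subst (asm) uniform_limit_cong'[where g = "\<lambda>N u. \<Sum>k<N. w k * (t * u) ^ k" and i = "\<lambda>u. (1 - t * u) powr p"]) auto
  have bd: "bounded ((\<lambda>u::real. u ^ (m - 1) * (1 - u) powr p) ` {0..1})"
    by (intro compact_imp_bounded compact_continuous_image continuous_on_mult continuous_on_powr' continuous_intros) (use assms in auto)
  have bd2: "bounded ((\<lambda>u. (1 - t * u) powr p) ` {0..1})"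
    by (intro compact_imp_bounded compact_continuous_image continuous_on_powr' continuous_intros) (use assms tu in force)+
  have "uniform_limit {0..1} F G sequentially"
    unfolding F_def G_def
    by (rule uniform_lim_mult[OF uniform_limit_const ul0 bd bd2])
  moreover have "continuous_on {0..1} (F N)" for N
    unfolding F_def by (intro continuous_on_mult continuous_on_powr' continuous_intros) (use assms in auto)
  ultimately obtain I J where IJ: "\<And>N. (F N has_integral I N) {0..1}" "(G has_integral J) {0..1}" "I \<longlonglongrightarrow> J"
    by (rule uniform_limit_integral) (auto simp: trivial_limit_sequentially)
  have "((\<lambda>u. \<Sum>k<N. w k * t ^ k * (u ^ (m + k - 1) * (1 - u) powr p)) has_integral
      (\<Sum>k<N. w k * t ^ k * Beta (real (m + k)) (p + 1))) {0..1}" for N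
    by (intro has_integral_sum has_integral_mult_right has_integral_Beta_nat) (use assms in auto)
  moreover have "(\<Sum>k<N. w k * t ^ k * (u ^ (m + k - 1) * (1 - u) powr p)) = F N u" for N u
    unfolding F_def sum_distrib_left
  proof (rule sum.cong)
    fix k
    have "m + k - 1 = (m - 1) + k" using assms by simp
    then have "u ^ (m + k - 1) = u ^ (m - 1) * u ^ k" by (simp add: power_add)
    then show "w k * t ^ k * (u ^ (m + k - 1) * (1 - u) powr p) = u ^ (m - 1) * (1 - u) powr p * (w k * (t * u) ^ k)"
      by (simp add: power_mult_distrib mult_ac)
  qed auto
  ultimately have "I N = (\<Sum>k<N. w k * t ^ k * Beta (real (m + k)) (p + 1))" for N
    using IJ(1)[of N] by (metis (mono_tags, lifting) has_integral_cong has_integral_unique)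
  moreover have "w k * t ^ k * Beta (real (m + k)) (p + 1)
      = Beta (real m) (p + 1) * (hyp_coeff (real m) (-p) (real m + p + 1) k * t ^ k)" for k
    using assms Beta_add_nat_left[of "real m" "p + 1" k]
    by (simp add: w_def hyp_coeff_def add.assoc mult_ac)
  ultimately have "I N = (\<Sum>k<N. Beta (real m) (p + 1) * (hyp_coeff (real m) (-p) (real m + p + 1) k * t ^ k))" for N
    by (simp only:)
  then have "I = (\<lambda>N. \<Sum>k<N. Beta (real m) (p + 1) * (hyp_coeff (real m) (-p) (real m + p + 1) k * t ^ k))"
    by blast
  then have "(\<lambda>k. Beta (real m) (p + 1) * (hyp_coeff (real m) (-p) (real m + p + 1) k * t ^ k)) sums J"
    using IJ(3) by (simp only: sums_def)
  moreover have "(\<lambda>k. hyp_coeff (real m) (-p) (real m + p + 1) k * t ^ k) sums hyp2F1 (real m) (-p) (real m + p + 1) t"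
    unfolding hyp2F1_eq_powser
    by (intro summable_sums hyp_coeff_summable) (use assms in auto)
  then have "(\<lambda>k. Beta (real m) (p + 1) * (hyp_coeff (real m) (-p) (real m + p + 1) k * t ^ k)) sums
     (Beta (real m) (p + 1) * hyp2F1 (real m) (-p) (real m + p + 1) t)"
    by (rule sums_mult)
  ultimately have "J = Beta (real m) (p + 1) * hyp2F1 (real m) (-p) (real m + p + 1) t"
    by (rule sums_unique2)
  then show ?thesis using IJ(2) unfolding G_def by simp
qed

context
  fixes p t :: real and m :: nat
  assumes m: "m \<ge> 1" and p: "p > 0" and t: "0 \<le> t" "t < 1"
begin

lemma Beta_pos: "Beta (real m) (p + 1) > 0"
  using m p by (simp add: Beta_def Gamma_real_pos)

text \<open>By Euler's integral F(t) is the mean of (1 - t u)^p under a Beta distribution of u in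
  [0, 1], and there 1 - t u >= 1 - t.\<close>

lemma hyp2F1_ge_powr: "(1 - t) powr p \<le> hyp2F1 (real m) (-p) (real m + p + 1) t"
proof -
  have "((\<lambda>u. (1 - t) powr p * (u ^ (m - 1) * (1 - u) powr p)) has_integral (1 - t) powr p * Beta (real m) (p + 1)) {0..1}"
    by (intro has_integral_mult_right has_integral_Beta_nat) (use m p in auto)
  then have "(1 - t) powr p * Beta (real m) (p + 1) \<le> Beta (real m) (p + 1) * hyp2F1 (real m) (-p) (real m + p + 1) t"
  proof (rule has_integral_le[OF _ hyp2F1_Euler_integral[OF m p t]])
    fix u :: real assume u: "u \<in> {0..1}"
    have "t * u \<le> t" using t u by (auto intro: mult_left_le)
    then have "(1 - t) powr p \<le> (1 - t * u) powr p" using t p by (intro powr_mono2) auto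
    then have "(u ^ (m - 1) * (1 - u) powr p) * (1 - t) powr p \<le> (u ^ (m - 1) * (1 - u) powr p) * (1 - t * u) powr p"
      using u by (intro mult_left_mono) auto
    then show "(1 - t) powr p * (u ^ (m - 1) * (1 - u) powr p) \<le> u ^ (m - 1) * (1 - u) powr p * (1 - t * u) powr p"
      by (simp only: mult_ac)
  qed
  then show ?thesis using Beta_pos by (simp add: mult.commute)
qed

text \<open>The same mean, now with 1 - t u <= 1. This bound stays finite at t = 1, unlike the next
  one with its negative powers of 1 - t, and so yields convergence on all of Re s > -1.\<close>

lemma hyp2F1_le_1: "hyp2F1 (real m) (-p) (real m + p + 1) t \<le> 1"
proof -
  have "((\<lambda>u. u ^ (m - 1) * (1 - u) powr p) has_integral Beta (real m) (p + 1)) {0..1}"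
    by (intro has_integral_Beta_nat) (use m p in auto)
  then have "Beta (real m) (p + 1) * hyp2F1 (real m) (-p) (real m + p + 1) t \<le> Beta (real m) (p + 1)"
  proof (rule has_integral_le[OF hyp2F1_Euler_integral[OF m p t]])
    fix u :: real assume u: "u \<in> {0..1}"
    have "t * u \<le> 1" using t u by (auto intro: mult_le_one)
    then have "(1 - t * u) powr p \<le> 1 powr p" using t u p by (intro powr_mono2) auto
    then show "u ^ (m - 1) * (1 - u) powr p * (1 - t * u) powr p \<le> u ^ (m - 1) * (1 - u) powr p"
      using u by (intro mult_left_le) auto
  qed
  then show ?thesis using Beta_pos by simp
qed

text \<open>From \<open>1 - t u \<le> (1 - t) + (1 - u)\<close>: for \<open>0 < a\<close>, \<open>0 \<le> b\<close> and \<open>p \<le> N\<close> one has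
  \<open>(a + b)\<^sup>p \<le> a\<^bsup>p - N\<^esup> (a + b)\<^sup>N\<close>, and the last factor is expanded binomially.\<close>

lemma hyp2F1_le_sum:
  assumes N: "p \<le> real N"
  shows "hyp2F1 (real m) (-p) (real m + p + 1) t \<le>
    (\<Sum>i\<le>N. real (N choose i) * (pochhammer (p + 1) i / pochhammer (real m + p + 1) i) * (1 - t) powr (p - real i))"
proof -
  \<comment> \<open>Each additional factor (1 - u)^i costs a quotient of order m^(-i); this is the
    decay that later offsets the singular powers of 1 - t.\<close>
  have B: "Beta (real m) (p + real i + 1) = Beta (real m) (p + 1) * (pochhammer (p + 1) i / pochhammer (real m + p + 1) i)" for i
    using Beta_add_nat_left[of "p + 1" "real m" i] m p by (simp add: Beta_commute add_ac)
  have "((\<lambda>u. \<Sum>i\<le>N. real (N choose i) * (1 - t) powr (p - real i) * (u ^ (m - 1) * (1 - u) powr (p + real i)))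
     has_integral (\<Sum>i\<le>N. real (N choose i) * (1 - t) powr (p - real i) * Beta (real m) (p + real i + 1))) {0..1}"
    by (intro has_integral_sum has_integral_mult_right has_integral_Beta_nat) (use m p in auto)
  then have rhs: "((\<lambda>u. \<Sum>i\<le>N. real (N choose i) * (1 - t) powr (p - real i) * (u ^ (m - 1) * (1 - u) powr (p + real i)))
     has_integral (\<Sum>i\<le>N. real (N choose i) * (1 - t) powr (p - real i) * Beta (real m) (p + real i + 1))) {0<..<1}"
    by (simp add: has_integral_Icc_iff_Ioo)
  have lhs: "((\<lambda>u. u ^ (m - 1) * (1 - u) powr p * (1 - t * u) powr p) has_integral
     Beta (real m) (p + 1) * hyp2F1 (real m) (-p) (real m + p + 1) t) {0<..<1}"
    using hyp2F1_Euler_integral[OF m p t] by (simp add: has_integral_Icc_iff_Ioo)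
  have "Beta (real m) (p + 1) * hyp2F1 (real m) (-p) (real m + p + 1) t
    \<le> (\<Sum>i\<le>N. real (N choose i) * (1 - t) powr (p - real i) * Beta (real m) (p + real i + 1))"
  proof (rule has_integral_le[OF lhs rhs])
    fix u :: real assume u: "u \<in> {0<..<1}"
    let ?x = "1 - t" and ?y = "1 - u"
    have xy: "?x > 0" "?y > 0" using t u by auto
    have "t * u \<le> u" using t u by (intro mult_left_le_one_le) auto
    then have tu: "1 - t * u \<ge> 0" using xy by linarith
    have "1 - t * u \<le> ?x + ?y" using mult_nonneg_nonneg[of ?x ?y] xy by (simp add: algebra_simps)
    then have "(1 - t * u) powr p \<le> (?x + ?y) powr p" using tu p by (intro powr_mono2) auto
    also have "\<dots> = (?x + ?y) powr (real N) * (?x + ?y) powr (p - real N)"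
      by (subst powr_add[symmetric]) simp
    also have "\<dots> \<le> (?x + ?y) powr (real N) * ?x powr (p - real N)"
      using xy N by (intro mult_left_mono powr_mono2') auto
    also have "(?x + ?y) powr (real N) = (?y + ?x) ^ N"
      using xy by (subst powr_realpow) (auto simp: add.commute)
    also have "(?y + ?x) ^ N * ?x powr (p - real N) = (\<Sum>i\<le>N. real (N choose i) * ?x powr (p - real i) * ?y powr (real i))"
      unfolding binomial_ring sum_distrib_right
    proof (rule sum.cong)
      fix i assume "i \<in> {..N}"
      then have "?x ^ (N - i) * ?x powr (p - real N) = ?x powr (p - real i)"
        using xy by (simp add: powr_realpow[symmetric] powr_add[symmetric] of_nat_diff)
      then show "real (N choose i) * ?y ^ i * ?x ^ (N - i) * ?x powr (p - real N)
          = real (N choose i) * ?x powr (p - real i) * ?y powr (real i)"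
        using xy by (simp add: powr_realpow)
    qed simp
    finally have "(u ^ (m - 1) * ?y powr p) * (1 - t * u) powr p
        \<le> (u ^ (m - 1) * ?y powr p) * (\<Sum>i\<le>N. real (N choose i) * ?x powr (p - real i) * ?y powr (real i))"
      using u by (intro mult_left_mono) auto
    also have "\<dots> = (\<Sum>i\<le>N. real (N choose i) * ?x powr (p - real i) * (u ^ (m - 1) * ?y powr (p + real i)))"
      by (simp add: sum_distrib_left powr_add mult_ac)
    finally show "u ^ (m - 1) * ?y powr p * (1 - t * u) powr p \<le>
       (\<Sum>i\<le>N. real (N choose i) * ?x powr (p - real i) * (u ^ (m - 1) * ?y powr (p + real i)))" .
  qed
  also have "\<dots> = Beta (real m) (p + 1) * (\<Sum>i\<le>N. real (N choose i) * (pochhammer (p + 1) i / pochhammer (real m + p + 1) i) * (1 - t) powr (p - real i))"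
    unfolding B sum_distrib_left by (intro sum.cong) (auto simp: mult_ac)
  finally show ?thesis using Beta_pos by (simp only: mult_le_cancel_left_pos)
qed

end

section \<open>The recurrence for the moments\<close>

text \<open>Coefficients of the recurrence in \<open>s\<close> satisfied by the moments
  \<open>\<integral> t\<^bsup>m + p\<^esup> (1 - t)\<^sup>s F(t)\<^sup>2 dt\<close> with \<open>F = hyp2F1 m (-p) (m + p + 1)\<close>. The growth in \<open>m\<close> is
  what matters: the second coefficient does not depend on \<open>m\<close>, the last two are quadratic.\<close>

definition rec0 :: "'a::comm_ring_1 \<Rightarrow> 'a \<Rightarrow> 'a" where
  "rec0 p s = (s + 2 + 2 * p) * (s + 3 + 4 * p)"

definition rec1 :: "'a::comm_ring_1 \<Rightarrow> 'a \<Rightarrow> 'a" where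
  "rec1 p s = - (s + 4 + 3 * p) * (s + 3 + 2 * p) * (s + 2)
     - (s + 3 + 4 * p) * ((s + 3 + 2 * p) * (s + 2) + (s + 2 + 2 * p) * (s + 2 + p))"

definition rec2 :: "'a::comm_ring_1 \<Rightarrow> 'a \<Rightarrow> 'a \<Rightarrow> 'a" where
  "rec2 p m s =
     (s + 4 + 3 * p - m) * ((s + 4 + 2 * p) * (s + 3) + (s + 3 + 2 * p) * (m + p + s + 3) - 2 * m * p)
     + (s + 3 + 4 * p) * ((s + 3 + 2 * p) * (m + p + s + 3) - 2 * m * p)
     - 2 * m * p * (m + p + 2 * s + 6)"

definition rec3 :: "'a::comm_ring_1 \<Rightarrow> 'a \<Rightarrow> 'a \<Rightarrow> 'a" where
  "rec3 p m s = (s + 4 + 3 * p - m) * (2 * m * p - (s + 4 + 2 * p) * (m + p + s + 4))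
     + 2 * m * p * (m + p + s + 4)"

section \<open>Integration by parts against the Jacobi weight\<close>

definition Jacobi_weight :: "real \<Rightarrow> real \<Rightarrow> real \<Rightarrow> real" where
  "Jacobi_weight q \<sigma> t = t powr q * (1 - t) powr \<sigma>"

lemma Jacobi_weight_add_1: "t \<le> 1 \<Longrightarrow> Jacobi_weight q (\<sigma> + 1) t = Jacobi_weight q \<sigma> t * (1 - t)"
  by (cases "t = 1") (auto simp: Jacobi_weight_def powr_add)

text \<open>Nothing is assumed about h at 0 and 1: the weight is 0 there, and the product is
  dominated by \<open>?B\<close>, which is continuous and vanishes at both ends. The exponent 4 is
  that of the bounds on products of two of F and t F'.\<close>

lemma continuous_on_Jacobi_weight_mult:
  fixes h :: "real \<Rightarrow> real"
  assumes "q > 0" "\<sigma> > 4" "continuous_on {0<..<1} h"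
    and bd: "\<And>t. 0 < t \<Longrightarrow> t < 1 \<Longrightarrow> \<bar>h t\<bar> \<le> C / (1 - t) ^ 4"
  shows "continuous_on {0..1} (\<lambda>t. Jacobi_weight q \<sigma> t * h t)"
proof -
  let ?G = "\<lambda>t. Jacobi_weight q \<sigma> t * h t"
  let ?B = "\<lambda>t. C * (t powr q * (1 - t) powr (\<sigma> - 4))"
  have le: "\<bar>?G t\<bar> \<le> ?B t" if "t \<in> {0..1}" for t
  proof (cases "0 < t \<and> t < 1")
    case True
    have "\<bar>?G t\<bar> = t powr q * (1 - t) powr \<sigma> * \<bar>h t\<bar>"
      by (simp add: Jacobi_weight_def abs_mult)
    also have "\<dots> \<le> t powr q * (1 - t) powr \<sigma> * (C / (1 - t) ^ 4)"
      using bd True by (intro mult_left_mono) auto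
    also have "(1 - t) ^ 4 = (1 - t) powr 4" using True by (simp add: powr_numeral)
    also have "t powr q * (1 - t) powr \<sigma> * (C / (1 - t) powr 4) = ?B t"
      by (simp add: powr_diff)
    finally show ?thesis .
  qed (use that in \<open>auto simp: Jacobi_weight_def\<close>)
  have cB: "continuous_on {0..1} ?B"
    by (intro continuous_on_mult continuous_on_const continuous_on_powr' continuous_intros) (use assms in auto)
  have endpoint: "continuous (at t within {0..1}) ?G" if "t \<in> {0..1}" "?B t = 0" for t
  proof -
    have "(?B \<longlongrightarrow> 0) (at t within {0..1})"
      using cB that by (metis (no_types, lifting) continuous_on_def)
    then have "(?G \<longlongrightarrow> 0) (at t within {0..1})"
      by (rule Lim_null_comparison[rotated]) (use le in \<open>auto simp: eventually_at_filter\<close>)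
    moreover have "?G t = 0" using le[OF that(1)] that(2) by simp
    ultimately show ?thesis by (simp only: continuous_within)
  qed
  have mid: "continuous (at t within {0..1}) ?G" if "0 < t" "t < 1" for t
  proof -
    have "continuous_on {0<..<1} ?G"
      unfolding Jacobi_weight_def by (intro continuous_intros assms) auto
    then have "isCont ?G t" using that by (simp add: continuous_on_eq_continuous_at)
    then show ?thesis by (rule continuous_at_imp_continuous_at_within)
  qed
  show ?thesis unfolding continuous_on_eq_continuous_within
  proof
    fix t :: real assume t: "t \<in> {0..1}"
    show "continuous (at t within {0..1}) ?G"
    proof (cases "0 < t \<and> t < 1")
      case False
      then have "t = 0 \<or> t = 1" using t by auto
      then show ?thesis using endpoint[OF t] by auto
    qed (use mid in auto)
  qed
qed

text \<open>The integrand is the derivative of t^(q+1) (1 - t)^(tau+1) h(t), which vanishes at both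
  ends. In \<open>deriv\<close>, g is t h'; it enters only through (1 - t) g because the
  differential equation gives (1 - t) v without division.\<close>

lemma Jacobi_weight_parts:
  fixes h g k :: "real \<Rightarrow> real"
  assumes "q > 0" "\<tau> > 3"
    and deriv: "\<And>t. 0 < t \<Longrightarrow> t < 1 \<Longrightarrow> \<exists>g. (h has_real_derivative g / t) (at t) \<and> k t = (1 - t) * g"
    and bd: "\<And>t. 0 < t \<Longrightarrow> t < 1 \<Longrightarrow> \<bar>h t\<bar> \<le> C / (1 - t) ^ 4"
  shows "((\<lambda>t. Jacobi_weight q \<tau> t * (((q + 1) * (1 - t) - (\<tau> + 1) * t) * h t + k t)) has_integral 0) {0..1}"
proof -
  let ?F = "\<lambda>t. Jacobi_weight (q + 1) (\<tau> + 1) t * h t"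
  have "isCont h t" if "0 < t" "t < 1" for t using deriv[OF that] DERIV_isCont by blast
  then have ch: "continuous_on {0<..<1} h" by (intro continuous_at_imp_continuous_on) auto
  have "((\<lambda>t. Jacobi_weight q \<tau> t * (((q + 1) * (1 - t) - (\<tau> + 1) * t) * h t + k t)) has_integral ?F 1 - ?F 0) {0..1}"
  proof (rule fundamental_theorem_of_calculus_interior)
    show "continuous_on {0..1} ?F"
      by (rule continuous_on_Jacobi_weight_mult[OF _ _ ch bd]) (use assms in auto)
    fix t :: real assume t: "t \<in> {0<..<1}"
    then obtain g where g: "(h has_real_derivative g / t) (at t)" "k t = (1 - t) * g"
      using deriv by auto
    have "(?F has_real_derivative
        ((q + 1) * t powr q * (1 - t) powr (\<tau> + 1) - (\<tau> + 1) * (1 - t) powr \<tau> * t powr (q + 1)) * h t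
        + g / t * (t powr (q + 1) * (1 - t) powr (\<tau> + 1))) (at t)"
      unfolding Jacobi_weight_def by (rule derivative_eq_intros g refl | use t in simp)+
    moreover have "((q + 1) * t powr q * (1 - t) powr (\<tau> + 1) - (\<tau> + 1) * (1 - t) powr \<tau> * t powr (q + 1)) * h t
        + g / t * (t powr (q + 1) * (1 - t) powr (\<tau> + 1))
        = Jacobi_weight q \<tau> t * (((q + 1) * (1 - t) - (\<tau> + 1) * t) * h t + k t)"
      using t g(2) by (simp add: Jacobi_weight_def powr_add) (simp add: algebra_simps)
    ultimately show "(?F has_vector_derivative Jacobi_weight q \<tau> t * (((q + 1) * (1 - t) - (\<tau> + 1) * t) * h t + k t)) (at t)"
      by (simp add: has_real_derivative_iff_has_vector_derivative)
  qed simp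
  then show ?thesis by (simp add: Jacobi_weight_def)
qed

context
  fixes p :: real and m :: nat
  assumes m: "m \<ge> 1" and p: "p > 0"
begin

private definition "q = real m + p"
private definition "H = hyp2F1 (real m) (-p) (real m + p + 1)"
private definition "U = theta_hyp2F1 (real m) (-p) (real m + p + 1)"
text \<open>Since H solves an equation of second order, t d/dt maps the span of H^2, H U, U^2 to
  itself up to the factor 1 - t. The three moment families are therefore closed under integration by
  parts.\<close>

private definition "A \<sigma> = integral {0..1} (\<lambda>t. Jacobi_weight q \<sigma> t * (H t)\<^sup>2)"
private definition "B \<sigma> = integral {0..1} (\<lambda>t. Jacobi_weight q \<sigma> t * (H t * U t))"
private definition "D \<sigma> = integral {0..1} (\<lambda>t. Jacobi_weight q \<sigma> t * (U t)\<^sup>2)"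

private lemma q: "q > 0" using m p by (simp add: q_def)

private lemma ab: "0 < real m" "real m \<le> real m + p + 1" "- p \<le> 1" using m p by auto

private lemma dH: "0 < t \<Longrightarrow> t < 1 \<Longrightarrow> (H has_real_derivative U t / t) (at t)"
  unfolding H_def U_def by (rule DERIV_hyp2F1[OF ab])

text \<open>With c - 1 = q and a + b = q - 2 p the equation splits off -q (1 - t) U. Against the
  weight t^q this cancels the term q (1 - t) from the derivative of the weight, completely in
  \<open>E2\<close> and with one copy left over in \<open>E3\<close>.\<close>

private lemma dU:
  assumes "0 < t" "t < 1"
  obtains v where "(U has_real_derivative v / t) (at t)"
    "(1 - t) * v = - q * (1 - t) * U t - 2 * p * t * U t - real m * p * t * H t"
proof -
  obtain v where v: "(U has_real_derivative v / t) (at t)"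
    "(1 - t) * v = - (real m + p + 1 - 1) * U t + t * (real m + - p) * U t + real m * - p * t * H t"
    using DERIV_theta_hyp2F1[OF ab assms] unfolding H_def U_def by blast
  have "(1 - t) * v = - q * (1 - t) * U t - 2 * p * t * U t - real m * p * t * H t"
    unfolding v(2) q_def by (simp add: algebra_simps)
  with v(1) show ?thesis using that by blast
qed

private lemma bounds:
  obtains C where "\<And>t. 0 < t \<Longrightarrow> t < 1 \<Longrightarrow> \<bar>(H t)\<^sup>2\<bar> \<le> C / (1 - t) ^ 4"
    "\<And>t. 0 < t \<Longrightarrow> t < 1 \<Longrightarrow> \<bar>H t * U t\<bar> \<le> C / (1 - t) ^ 4"
    "\<And>t. 0 < t \<Longrightarrow> t < 1 \<Longrightarrow> \<bar>(U t)\<^sup>2\<bar> \<le> C / (1 - t) ^ 4"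
proof -
  obtain C where C: "C > 0" "\<And>t. 0 \<le> t \<Longrightarrow> t < 1 \<Longrightarrow> \<bar>H t\<bar> \<le> C / (1 - t)"
    "\<And>t. 0 \<le> t \<Longrightarrow> t < 1 \<Longrightarrow> \<bar>U t\<bar> \<le> C / (1 - t) ^ 2"
    using hyp2F1_theta_bounds[OF ab] unfolding H_def U_def by blast
  have H: "\<bar>H t\<bar> \<le> C / (1 - t) ^ 2" if "0 < t" "t < 1" for t
  proof -
    have "(1 - t) ^ 2 \<le> 1 - t" using that by (simp add: power2_eq_square mult_left_le)
    then have "C / (1 - t) \<le> C / (1 - t) ^ 2" using that C(1) by (intro divide_left_mono) auto
    then show ?thesis using C(2)[of t] that by simp
  qed
  have e: "(C / (1 - t) ^ 2) * (C / (1 - t) ^ 2) = C\<^sup>2 / (1 - t) ^ 4" for t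
    by (simp add: power2_eq_square power4_eq_xxxx)
  have pr: "\<bar>a * b\<bar> \<le> C\<^sup>2 / (1 - t) ^ 4" if "\<bar>a\<bar> \<le> C / (1 - t) ^ 2" "\<bar>b\<bar> \<le> C / (1 - t) ^ 2" for a b t
    unfolding abs_mult e[symmetric] using that C(1) by (intro mult_mono) auto
  show ?thesis
  proof (rule that[of "C\<^sup>2"])
    fix t :: real assume t: "0 < t" "t < 1"
    have H: "\<bar>H t\<bar> \<le> C / (1 - t) ^ 2" and U: "\<bar>U t\<bar> \<le> C / (1 - t) ^ 2" using H C(3) t by auto
    show "\<bar>(H t)\<^sup>2\<bar> \<le> C\<^sup>2 / (1 - t) ^ 4" "\<bar>H t * U t\<bar> \<le> C\<^sup>2 / (1 - t) ^ 4" "\<bar>(U t)\<^sup>2\<bar> \<le> C\<^sup>2 / (1 - t) ^ 4"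
      using pr[OF H H] pr[OF H U] pr[OF U U] by (simp_all only: power2_eq_square)
  qed
qed

private lemma cont: "continuous_on {0<..<1} H" "continuous_on {0<..<1} U"
proof -
  have "isCont H t" "isCont U t" if "0 < t" "t < 1" for t
    using dH[OF that] dU[OF that] DERIV_isCont by blast+
  then show "continuous_on {0<..<1} H" "continuous_on {0<..<1} U"
    by (auto intro: continuous_at_imp_continuous_on)
qed

private lemma has_A: "\<sigma> > 4 \<Longrightarrow> ((\<lambda>t. Jacobi_weight q \<sigma> t * (H t)\<^sup>2) has_integral A \<sigma>) {0..1}"
  and has_B: "\<sigma> > 4 \<Longrightarrow> ((\<lambda>t. Jacobi_weight q \<sigma> t * (H t * U t)) has_integral B \<sigma>) {0..1}"
  and has_D: "\<sigma> > 4 \<Longrightarrow> ((\<lambda>t. Jacobi_weight q \<sigma> t * (U t)\<^sup>2) has_integral D \<sigma>) {0..1}"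
proof -
  obtain C where C: "\<And>t. 0 < t \<Longrightarrow> t < 1 \<Longrightarrow> \<bar>(H t)\<^sup>2\<bar> \<le> C / (1 - t) ^ 4"
    "\<And>t. 0 < t \<Longrightarrow> t < 1 \<Longrightarrow> \<bar>H t * U t\<bar> \<le> C / (1 - t) ^ 4"
    "\<And>t. 0 < t \<Longrightarrow> t < 1 \<Longrightarrow> \<bar>(U t)\<^sup>2\<bar> \<le> C / (1 - t) ^ 4" using bounds by blast
  assume s: "\<sigma> > 4"
  note * = integrable_integral[OF integrable_continuous_real[OF continuous_on_Jacobi_weight_mult[OF q s]]]
  show "((\<lambda>t. Jacobi_weight q \<sigma> t * (H t)\<^sup>2) has_integral A \<sigma>) {0..1}"
    unfolding A_def by (rule *[OF _ C(1)]) (intro continuous_intros cont)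
  show "((\<lambda>t. Jacobi_weight q \<sigma> t * (H t * U t)) has_integral B \<sigma>) {0..1}"
    unfolding B_def by (rule *[OF _ C(2)]) (intro continuous_intros cont)
  show "((\<lambda>t. Jacobi_weight q \<sigma> t * (U t)\<^sup>2) has_integral D \<sigma>) {0..1}"
    unfolding D_def by (rule *[OF _ C(3)]) (intro continuous_intros cont)
qed

text \<open>\<open>E1\<close>, \<open>E2\<close> and \<open>E3\<close> are the integrations by parts
  for H^2, H U and U^2. Writing t = 1 - (1 - t) turns every remaining factor t into a shift of
  sigma.\<close>

private lemma E1:
  assumes "\<sigma> > 5"
  shows "(q + 1 + \<sigma>) * A \<sigma> - \<sigma> * A (\<sigma> - 1) + 2 * B \<sigma> = 0"
proof -
  obtain C where C: "\<And>t. 0 < t \<Longrightarrow> t < 1 \<Longrightarrow> \<bar>(H t)\<^sup>2\<bar> \<le> C / (1 - t) ^ 4" using bounds by metis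
  have "((\<lambda>t. Jacobi_weight q (\<sigma> - 1) t * (((q + 1) * (1 - t) - (\<sigma> - 1 + 1) * t) * (H t)\<^sup>2
      + (1 - t) * (2 * H t * U t))) has_integral 0) {0..1}"
  proof (rule Jacobi_weight_parts[OF q _ _ C])
    fix t :: real assume t: "0 < t" "t < 1"
    have "((\<lambda>t. (H t)\<^sup>2) has_real_derivative 2 * H t * U t / t) (at t)"
      by (rule derivative_eq_intros dH t refl)+ simp
    then show "\<exists>g. ((\<lambda>t. (H t)\<^sup>2) has_real_derivative g / t) (at t) \<and> (1 - t) * (2 * H t * U t) = (1 - t) * g" by blast
  qed (use assms in auto)
  moreover have "((\<lambda>t. (q + 1 + \<sigma>) * (Jacobi_weight q \<sigma> t * (H t)\<^sup>2) - \<sigma> * (Jacobi_weight q (\<sigma> - 1) t * (H t)\<^sup>2)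
      + 2 * (Jacobi_weight q \<sigma> t * (H t * U t))) has_integral (q + 1 + \<sigma>) * A \<sigma> - \<sigma> * A (\<sigma> - 1) + 2 * B \<sigma>) {0..1}"
    by (intro has_integral_add has_integral_diff has_integral_mult_right has_A has_B) (use assms in auto)
  moreover have "(q + 1 + \<sigma>) * (Jacobi_weight q \<sigma> t * (H t)\<^sup>2) - \<sigma> * (Jacobi_weight q (\<sigma> - 1) t * (H t)\<^sup>2)
      + 2 * (Jacobi_weight q \<sigma> t * (H t * U t)) = Jacobi_weight q (\<sigma> - 1) t * (((q + 1) * (1 - t) - (\<sigma> - 1 + 1) * t) * (H t)\<^sup>2
      + (1 - t) * (2 * H t * U t))" if "t \<in> {0..1}" for t
  proof -
    have w: "Jacobi_weight q \<sigma> t = Jacobi_weight q (\<sigma> - 1) t * (1 - t)"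
      using that Jacobi_weight_add_1[of t q "\<sigma> - 1"] by simp
    show ?thesis unfolding w by (simp add: algebra_simps)
  qed
  ultimately show ?thesis by (metis (mono_tags, lifting) has_integral_cong has_integral_unique)
qed

private lemma E2:
  assumes "\<sigma> > 4"
  shows "(\<sigma> + 2 + 2 * p) * B (\<sigma> + 1) - (\<sigma> + 1 + 2 * p) * B \<sigma> + D (\<sigma> + 1) - real m * p * (A \<sigma> - A (\<sigma> + 1)) = 0"
proof -
  obtain C where C: "\<And>t. 0 < t \<Longrightarrow> t < 1 \<Longrightarrow> \<bar>H t * U t\<bar> \<le> C / (1 - t) ^ 4" using bounds by metis
  let ?f = "\<lambda>t. Jacobi_weight q \<sigma> t * (((q + 1) * (1 - t) - (\<sigma> + 1) * t) * (H t * U t)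
      + ((1 - t) * (U t)\<^sup>2 + H t * (- q * (1 - t) * U t - 2 * p * t * U t - real m * p * t * H t)))"
  have "(?f has_integral 0) {0..1}"
  proof (rule Jacobi_weight_parts[OF q _ _ C])
    fix t :: real assume t: "0 < t" "t < 1"
    obtain v where v: "(U has_real_derivative v / t) (at t)"
      "(1 - t) * v = - q * (1 - t) * U t - 2 * p * t * U t - real m * p * t * H t" using dU[OF t] .
    have "((\<lambda>t. H t * U t) has_real_derivative (U t * U t + H t * v) / t) (at t)"
      using t by (auto intro!: derivative_eq_intros dH v(1) simp: field_simps)
    moreover have "(1 - t) * (U t)\<^sup>2 + H t * (- q * (1 - t) * U t - 2 * p * t * U t - real m * p * t * H t)
       = (1 - t) * (U t * U t + H t * v)"
      unfolding v(2)[symmetric] by (simp add: power2_eq_square algebra_simps)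
    ultimately show "\<exists>g. ((\<lambda>t. H t * U t) has_real_derivative g / t) (at t) \<and>
       (1 - t) * (U t)\<^sup>2 + H t * (- q * (1 - t) * U t - 2 * p * t * U t - real m * p * t * H t) = (1 - t) * g" by blast
  qed (use assms in auto)
  moreover have "((\<lambda>t. (\<sigma> + 2 + 2 * p) * (Jacobi_weight q (\<sigma> + 1) t * (H t * U t))
       - (\<sigma> + 1 + 2 * p) * (Jacobi_weight q \<sigma> t * (H t * U t)) + Jacobi_weight q (\<sigma> + 1) t * (U t)\<^sup>2
       - real m * p * (Jacobi_weight q \<sigma> t * (H t)\<^sup>2 - Jacobi_weight q (\<sigma> + 1) t * (H t)\<^sup>2)) has_integral
     (\<sigma> + 2 + 2 * p) * B (\<sigma> + 1) - (\<sigma> + 1 + 2 * p) * B \<sigma> + D (\<sigma> + 1) - real m * p * (A \<sigma> - A (\<sigma> + 1))) {0..1}"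
    by (intro has_integral_add has_integral_diff has_integral_mult_right has_A has_B has_D) (use assms in auto)
  moreover have "(\<sigma> + 2 + 2 * p) * (Jacobi_weight q (\<sigma> + 1) t * (H t * U t))
       - (\<sigma> + 1 + 2 * p) * (Jacobi_weight q \<sigma> t * (H t * U t)) + Jacobi_weight q (\<sigma> + 1) t * (U t)\<^sup>2
       - real m * p * (Jacobi_weight q \<sigma> t * (H t)\<^sup>2 - Jacobi_weight q (\<sigma> + 1) t * (H t)\<^sup>2) = ?f t" if "t \<in> {0..1}" for t
  proof -
    have w: "Jacobi_weight q (\<sigma> + 1) t = Jacobi_weight q \<sigma> t * (1 - t)"
      using that Jacobi_weight_add_1[of t q \<sigma>] by simp
    show ?thesis unfolding w by (simp add: algebra_simps power2_eq_square)
  qed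
  ultimately show ?thesis by (metis (mono_tags, lifting) has_integral_cong has_integral_unique)
qed

private lemma E3:
  assumes "\<sigma> > 4"
  shows "(\<sigma> + 2 + 4 * p - q) * D (\<sigma> + 1) - (\<sigma> + 1 + 4 * p) * D \<sigma> - 2 * real m * p * (B \<sigma> - B (\<sigma> + 1)) = 0"
proof -
  obtain C where C: "\<And>t. 0 < t \<Longrightarrow> t < 1 \<Longrightarrow> \<bar>(U t)\<^sup>2\<bar> \<le> C / (1 - t) ^ 4" using bounds by metis
  let ?f = "\<lambda>t. Jacobi_weight q \<sigma> t * (((q + 1) * (1 - t) - (\<sigma> + 1) * t) * (U t)\<^sup>2
      + 2 * U t * (- q * (1 - t) * U t - 2 * p * t * U t - real m * p * t * H t))"
  have "(?f has_integral 0) {0..1}"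
  proof (rule Jacobi_weight_parts[OF q _ _ C])
    fix t :: real assume t: "0 < t" "t < 1"
    obtain v where v: "(U has_real_derivative v / t) (at t)"
      "(1 - t) * v = - q * (1 - t) * U t - 2 * p * t * U t - real m * p * t * H t" using dU[OF t] .
    have "((\<lambda>t. (U t)\<^sup>2) has_real_derivative (2 * U t * v) / t) (at t)"
      using t by (auto intro!: derivative_eq_intros v(1) simp: field_simps)
    moreover have "2 * U t * (- q * (1 - t) * U t - 2 * p * t * U t - real m * p * t * H t)
       = (1 - t) * (2 * U t * v)"
      unfolding v(2)[symmetric] by (simp add: algebra_simps)
    ultimately show "\<exists>g. ((\<lambda>t. (U t)\<^sup>2) has_real_derivative g / t) (at t) \<and>
       2 * U t * (- q * (1 - t) * U t - 2 * p * t * U t - real m * p * t * H t) = (1 - t) * g" by blast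
  qed (use assms in auto)
  moreover have "((\<lambda>t. (\<sigma> + 2 + 4 * p - q) * (Jacobi_weight q (\<sigma> + 1) t * (U t)\<^sup>2)
       - (\<sigma> + 1 + 4 * p) * (Jacobi_weight q \<sigma> t * (U t)\<^sup>2)
       - 2 * real m * p * (Jacobi_weight q \<sigma> t * (H t * U t) - Jacobi_weight q (\<sigma> + 1) t * (H t * U t))) has_integral
     (\<sigma> + 2 + 4 * p - q) * D (\<sigma> + 1) - (\<sigma> + 1 + 4 * p) * D \<sigma> - 2 * real m * p * (B \<sigma> - B (\<sigma> + 1))) {0..1}"
    by (intro has_integral_add has_integral_diff has_integral_mult_right has_A has_B has_D) (use assms in auto)
  moreover have "(\<sigma> + 2 + 4 * p - q) * (Jacobi_weight q (\<sigma> + 1) t * (U t)\<^sup>2)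
       - (\<sigma> + 1 + 4 * p) * (Jacobi_weight q \<sigma> t * (U t)\<^sup>2)
       - 2 * real m * p * (Jacobi_weight q \<sigma> t * (H t * U t) - Jacobi_weight q (\<sigma> + 1) t * (H t * U t)) = ?f t" if "t \<in> {0..1}" for t
  proof -
    have w: "Jacobi_weight q (\<sigma> + 1) t = Jacobi_weight q \<sigma> t * (1 - t)"
      using that Jacobi_weight_add_1[of t q \<sigma>] by simp
    show ?thesis unfolding w by (simp add: algebra_simps power2_eq_square)
  qed
  ultimately show ?thesis by (metis (mono_tags, lifting) has_integral_cong has_integral_unique)
qed

lemma moment_integrable:
  "\<sigma> > 4 \<Longrightarrow> (\<lambda>t. Jacobi_weight (real m + p) \<sigma> t * (hyp2F1 (real m) (-p) (real m + p + 1) t)\<^sup>2) integrable_on {0..1}"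
  using has_A unfolding q_def H_def by blast

lemma moment_recurrence:
  fixes s :: real
  assumes "s > 4"
  defines "M \<equiv> \<lambda>\<sigma>. integral {0..1} (\<lambda>t. Jacobi_weight (real m + p) \<sigma> t * (hyp2F1 (real m) (-p) (real m + p + 1) t)\<^sup>2)"
  shows "(s + 1) * rec0 p s * M s + rec1 p s * M (s + 1) + rec2 p (real m) s * M (s + 2) + rec3 p (real m) s * M (s + 3) = 0"
proof -
  have M: "M = A" unfolding M_def A_def q_def H_def ..
  let ?m = "real m"
  \<comment> \<open>e and -g are the coefficients of D (s + 3) and D (s + 2) in X3 (s + 2).\<close>
  define e where "e = s + 4 + 4 * p - q"
  define g where "g = s + 3 + 4 * p"
  define X1 where "X1 \<sigma> = (q + 1 + \<sigma>) * A \<sigma> - \<sigma> * A (\<sigma> - 1) + 2 * B \<sigma>" for \<sigma>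
  define X2 where "X2 \<sigma> = (\<sigma> + 2 + 2 * p) * B (\<sigma> + 1) - (\<sigma> + 1 + 2 * p) * B \<sigma> + D (\<sigma> + 1) - ?m * p * (A \<sigma> - A (\<sigma> + 1))" for \<sigma>
  define X3 where "X3 \<sigma> = (\<sigma> + 2 + 4 * p - q) * D (\<sigma> + 1) - (\<sigma> + 1 + 4 * p) * D \<sigma> - 2 * ?m * p * (B \<sigma> - B (\<sigma> + 1))" for \<sigma>
  have "X1 \<sigma> = 0" if "\<sigma> > 5" for \<sigma> unfolding X1_def by (rule E1[OF that])
  moreover have "X2 \<sigma> = 0" "X3 \<sigma> = 0" if "\<sigma> > 4" for \<sigma>
    unfolding X2_def X3_def by (rule E2[OF that], rule E3[OF that])
  ultimately have "X1 (s + 1) = 0" "X1 (s + 2) = 0" "X1 (s + 3) = 0" "X2 (s + 1) = 0" "X2 (s + 2) = 0" "X3 (s + 2) = 0"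
    using assms(1) by auto
  \<comment> \<open>Elimination: the multiples 2 e and -2 g of X2 remove D (s + 3) and D (s + 2)
    from -2 X3; the multiples of X1 then remove B (s + 3), B (s + 2), B (s + 1) in turn. A (s)
    occurs only in X1 (s + 1), so its coefficient factors as (s + 1) g (s + 2 + 2 p).\<close>
  moreover have "(s + 1) * rec0 p s * A s + rec1 p s * A (s + 1) + rec2 p ?m s * A (s + 2) + rec3 p ?m s * A (s + 3)
     = - 2 * X3 (s + 2) + 2 * e * X2 (s + 2) - 2 * g * X2 (s + 1)
       - (e * (s + 4 + 2 * p) - 2 * ?m * p) * X1 (s + 3)
       + (e * (s + 3 + 2 * p) + g * (s + 3 + 2 * p) - 2 * ?m * p) * X1 (s + 2)
       - g * (s + 2 + 2 * p) * X1 (s + 1)"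
  proof -
    have s: "s + 1 + 1 = s + 2" "s + 2 + 1 = s + 3" "s + 1 - 1 = s" "s + 2 - 1 = s + 1" "s + 3 - 1 = s + 2"
      by simp_all
    show ?thesis
      unfolding X1_def X2_def X3_def e_def g_def rec0_def rec1_def rec2_def rec3_def q_def s
      by (simp only: ring_distribs) algebra
  qed
  ultimately show ?thesis unfolding M by simp
qed

end

section \<open>Analytic continuation\<close>

text \<open>For Re s < 0 the integrand may be unbounded at t = 1, so differentiation under the
  integral is applied on [0, c N] only. The omitted tail is at most C (1 - c N)^x / x with x = Re s
  + 1, which tends to 0 locally uniformly.\<close>

lemma holomorphic_powr_moment:
  fixes h :: "real \<Rightarrow> real"
  assumes cont: "continuous_on {0..<1} h" and bd: "\<And>t. 0 \<le> t \<Longrightarrow> t < 1 \<Longrightarrow> \<bar>h t\<bar> \<le> C"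
  shows "(\<lambda>s. integral {0..1} (\<lambda>t. of_real (1 - t) powr s * of_real (h t))) holomorphic_on {s. Re s > -1}"
proof -
  have C: "C \<ge> 0" using bd[of 0] by simp
  define F where "F s t = complex_of_real (1 - t) powr s * of_real (h t)" for s t
  define c where "c N = 1 - 1 / (real N + 1)" for N
  have c: "0 \<le> c N" "c N < 1" for N by (auto simp: c_def divide_simps)
  have normF: "norm (F s t) \<le> C * (1 - t) powr Re s" if "0 \<le> t" "t < 1" for s t
    using bd[OF that] that
    by (simp add: F_def norm_mult norm_powr_real_powr mult.commute[of C] mult_left_mono)
  have contF: "continuous_on {0..c N} (F s)" for s N
    unfolding F_def using c[of N]
    by (intro continuous_intros continuous_on_subset[OF cont]) (auto simp: complex_nonpos_Reals_iff)
  have contF1: "continuous_on {0..<1} (F s)" for s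
    unfolding F_def
    by (intro continuous_intros continuous_on_subset[OF cont]) (auto simp: complex_nonpos_Reals_iff)
  have dom: "(\<lambda>t. C * (1 - t) powr x) integrable_on {a..1}"
     "integral {a..1} (\<lambda>t. C * (1 - t) powr x) = C * ((1 - a) powr (x + 1) / (x + 1))" if "x > -1" "a \<le> 1" for x a :: real
  proof -
    let ?A = "\<lambda>t. - (C / (x + 1)) * (1 - t) powr (x + 1)"
    have "((\<lambda>t. C * (1 - t) powr x) has_integral ?A 1 - ?A a) {a..1}"
    proof (rule fundamental_theorem_of_calculus_interior)
      show "continuous_on {a..1} ?A"
        by (intro continuous_on_mult continuous_on_powr' continuous_intros) (use that in auto)
      fix t assume t: "t \<in> {a<..<1}"
      have "((\<lambda>t. (1 - t) powr (x + 1)) has_real_derivative ((x + 1) * (1 - t) powr (x + 1 - 1)) * (-1)) (at t)"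
        by (rule DERIV_chain2[OF has_real_derivative_powr])
           (use t in \<open>auto intro!: derivative_eq_intros\<close>)
      from DERIV_cmult[OF this, of "- (C / (x + 1))"]
      have "(?A has_real_derivative C * (1 - t) powr x) (at t)" using that by simp
      then show "(?A has_vector_derivative C * (1 - t) powr x) (at t)"
        unfolding has_real_derivative_iff_has_vector_derivative .
    qed (use that in auto)
    then show "(\<lambda>t. C * (1 - t) powr x) integrable_on {a..1}"
     "integral {a..1} (\<lambda>t. C * (1 - t) powr x) = C * ((1 - a) powr (x + 1) / (x + 1))"
      by (auto simp: has_integral_iff)
  qed
  have intF: "F s integrable_on {a..1}" if "Re s > -1" "0 \<le> a" "a \<le> 1" for s a
  proof -
    have "(\<lambda>t. C * (1 - t) powr Re s) integrable_on {a<..<1}"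
      using dom(1)[OF that(1,3)] by (simp add: integrable_on_Icc_iff_Ioo)
    moreover have "F s \<in> borel_measurable (lebesgue_on {a<..<1})"
      by (intro continuous_imp_measurable_on_sets_lebesgue continuous_on_subset[OF contF1]) (use that in auto)
    ultimately have "F s absolutely_integrable_on {a<..<1}"
      using normF that
      by (intro measurable_bounded_by_integrable_imp_absolutely_integrable[of _ _ "\<lambda>t. C * (1 - t) powr Re s"]) auto
    then have "F s integrable_on {a<..<1}" by (rule set_lebesgue_integral_eq_integral)
    then show ?thesis by (simp add: integrable_on_Icc_iff_Ioo)
  qed
  have hol: "(\<lambda>s. integral {0..c N} (F s)) holomorphic_on {s. Re s > -1}" for N
  proof -
    have "(\<lambda>s. integral (cbox 0 (c N)) (F s)) holomorphic_on {s. Re s > -1}"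
    proof (rule leibniz_rule_holomorphic)
      fix s t assume "t \<in> cbox 0 (c N)"
      then have t: "0 \<le> t" "t < 1" using c[of N] by auto
      show "((\<lambda>s. F s t) has_field_derivative Ln (of_real (1 - t)) * F s t) (at s within {s. Re s > -1})"
        unfolding F_def mult.assoc[symmetric]
        by (rule DERIV_cmult_right[OF has_field_derivative_at_within[OF has_field_derivative_powr_right]]) (use t in auto)
    next
      fix s show "F s integrable_on cbox 0 (c N)"
        using integrable_continuous_real[OF contF] by simp
    next
      have "continuous_on ({s. Re s > -1} \<times> {0..c N}) (\<lambda>(s, t). Ln (of_real (1 - t)) * F s t)"
        unfolding F_def case_prod_unfold using c[of N]
        by (intro continuous_intros continuous_on_compose2[OF cont]) (auto simp: complex_nonpos_Reals_iff)
      then show "continuous_on ({s. Re s > -1} \<times> cbox 0 (c N)) (\<lambda>(s, t). Ln (of_real (1 - t)) * F s t)" by simp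
    next
      show "convex {s. Re s > -1}" by (rule convex_halfspace_Re_gt)
    qed
    then show ?thesis by simp
  qed
  have "(\<lambda>s. integral {0..1} (F s)) holomorphic_on {s. Re s > -1}"
  proof (rule holomorphic_uniform_sequence[OF _ hol])
    show "open {s. Re s > -1}" by (rule open_halfspace_Re_gt)
    fix s0 assume s0: "s0 \<in> {s. Re s > -1}"
    \<comment> \<open>Half the distance from s0 to the line Re s = -1, so that Re s + 1 >= d on the
      whole closed ball of radius d; this makes the tail bound uniform.\<close>
    define d where "d = (Re s0 + 1) / 2"
    have d: "d > 0" using s0 by (simp add: d_def)
    have Re: "Re s + 1 \<ge> d" if "s \<in> cball s0 d" for s
    proof -
      have "\<bar>Re (s0 - s)\<bar> \<le> d" using that abs_Re_le_cmod[of "s0 - s"] by (simp add: dist_norm)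
      then have "Re s0 - Re s \<le> d" by simp
      moreover have "2 * d = Re s0 + 1" by (simp add: d_def)
      ultimately show ?thesis by linarith
    qed
    have bound: "norm (integral {0..c N} (F s) - integral {0..1} (F s)) \<le> C / d * (1 / (real N + 1)) powr d"
      if "s \<in> cball s0 d" for s N
    proof -
      have s: "Re s > -1" using Re[OF that] d by simp
      have "integral {0..1} (F s) = integral {0..c N} (F s) + integral {c N..1} (F s)"
        using c[of N] intF[OF s] by (intro Henstock_Kurzweil_Integration.integral_combine[symmetric]) auto
      then have "norm (integral {0..c N} (F s) - integral {0..1} (F s)) = norm (integral {c N..1} (F s))" by simp
      also have "\<dots> = norm (integral {c N<..<1} (F s))"
        by (simp add: integral_open_interval_real)
      also have "\<dots> \<le> integral {c N<..<1} (\<lambda>t. C * (1 - t) powr Re s)"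
        using intF[OF s, of "c N"] dom(1)[OF s, of "c N"] c[of N] normF
        by (intro integral_norm_bound_integral) (auto simp: integrable_on_Icc_iff_Ioo)
      also have "\<dots> = C * ((1 - c N) powr (Re s + 1) / (Re s + 1))"
        using dom(2)[OF s, of "c N"] c[of N] by (simp add: integral_open_interval_real)
      also have "\<dots> \<le> C * ((1 - c N) powr d / d)"
        using Re[OF that] d c[of N] C by (intro mult_left_mono frac_le powr_mono') auto
      also have "\<dots> = C / d * (1 / (real N + 1)) powr d" by (simp add: c_def)
      finally show ?thesis .
    qed
    have "(\<lambda>N. 1 / (real N + 1)) \<longlonglongrightarrow> 0" by real_asymp
    then have "(\<lambda>N. C / d * (1 / (real N + 1)) powr d) \<longlonglongrightarrow> C / d * 0 powr d"
      using d by (intro tendsto_mult tendsto_const tendsto_powr2) auto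
    then have lim: "(\<lambda>N. C / d * (1 / (real N + 1)) powr d) \<longlonglongrightarrow> 0" by simp
    have "uniform_limit (cball s0 d) (\<lambda>N s. integral {0..c N} (F s)) (\<lambda>s. integral {0..1} (F s)) sequentially"
      unfolding uniform_limit_iff
    proof (intro allI impI)
      fix e :: real assume "e > 0"
      with lim have "\<forall>\<^sub>F N in sequentially. C / d * (1 / (real N + 1)) powr d < e" by (rule order_tendstoD)
      then show "\<forall>\<^sub>F N in sequentially. \<forall>s\<in>cball s0 d. dist (integral {0..c N} (F s)) (integral {0..1} (F s)) < e"
      proof eventually_elim
        case (elim N)
        show ?case unfolding dist_norm using bound elim by (meson le_less_trans)
      qed
    qed
    moreover have "cball s0 d \<subseteq> {s. Re s > -1}" using Re d by force
    ultimately show "\<exists>d>0. cball s0 d \<subseteq> {s. Re s > -1} \<and>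
       uniform_limit (cball s0 d) (\<lambda>N s. integral {0..c N} (F s)) (\<lambda>s. integral {0..1} (F s)) sequentially"
      using d by blast
  qed
  then show ?thesis unfolding F_def .
qed

text \<open>Solving the recurrence for its first term extends f to the left by one unit at a time.
  Closure of Z under s -> s - 1 ensures that s + 1, s + 2, s + 3 avoid Z whenever s does, so off Z
  only analytic values are combined and divided by a nonzero P.\<close>

lemma recurrence_continuation:
  fixes f P c1 c2 c3 :: "complex \<Rightarrow> complex" and Z :: "complex set"
  assumes f: "f holomorphic_on {s. Re s > -1}"
    and an: "P analytic_on UNIV" "c1 analytic_on UNIV" "c2 analytic_on UNIV" "c3 analytic_on UNIV"
    and rec: "\<And>s. Re s > -1 \<Longrightarrow> P s * f s + c1 s * f (s + 1) + c2 s * f (s + 2) + c3 s * f (s + 3) = 0"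
    and P: "\<And>s. Re s > -1 \<Longrightarrow> P s \<noteq> 0" "\<And>s. P s = 0 \<Longrightarrow> s \<in> Z"
    and Z: "\<And>s. s + 1 \<in> Z \<Longrightarrow> s \<in> Z"
  obtains g where "g meromorphic_on UNIV" "\<And>s. Re s > -1 \<Longrightarrow> g s = f s" "\<And>s. s \<notin> Z \<Longrightarrow> g analytic_on {s}"
    "\<And>s. s \<notin> Z \<Longrightarrow> P s * g s + c1 s * g (s + 1) + c2 s * g (s + 2) + c3 s * g (s + 3) = 0"
proof -
  \<comment> \<open>\<open>G k\<close> is the candidate on Re s > -1 - k; elsewhere its values are
    junk. On the region of \<open>G k\<close> it agrees with \<open>G (Suc k)\<close>, at the first
    stage by the recurrence for f and afterwards by induction.\<close>
  define G where "G = rec_nat f (\<lambda>_ g s. - (c1 s * g (s + 1) + c2 s * g (s + 2) + c3 s * g (s + 3)) / P s)"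
  have G0: "G 0 = f" by (simp add: G_def)
  have GS: "G (Suc k) = (\<lambda>s. - (c1 s * G k (s + 1) + c2 s * G k (s + 2) + c3 s * G k (s + 3)) / P s)" for k
    by (simp add: G_def)
  define T where "T k = {s. Re s > -1 - real k}" for k
  have opT: "open (T k)" for k unfolding T_def by (rule open_halfspace_Re_gt)
  have Zs: "s + 1 \<notin> Z" "s + 2 \<notin> Z" "s + 3 \<notin> Z" if "s \<notin> Z" for s
    using Z[of s] Z[of "s + 1"] Z[of "s + 2"] that by (auto simp: add.assoc)
  have cons: "G (Suc k) s = G k s" if "s \<in> T k" for k s
    using that
  proof (induction k arbitrary: s)
    case 0
    then have s: "Re s > -1" by (simp add: T_def)
    have "P s * f s = - (c1 s * f (s + 1) + c2 s * f (s + 2) + c3 s * f (s + 3))"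
      using rec[OF s] by (simp only: eq_neg_iff_add_eq_0 add.assoc)
    then show ?case unfolding GS G0 using P(1)[OF s] by (metis nonzero_mult_div_cancel_left)
  next
    case (Suc k)
    then have "s + 1 \<in> T k" "s + 2 \<in> T k" "s + 3 \<in> T k" by (auto simp: T_def)
    note IH = this[THEN Suc.IH]
    have "G (Suc (Suc k)) s = - (c1 s * G (Suc k) (s + 1) + c2 s * G (Suc k) (s + 2) + c3 s * G (Suc k) (s + 3)) / P s"
      by (simp only: GS[of "Suc k"])
    also have "\<dots> = G (Suc k) s" unfolding IH by (simp only: GS[of k])
    finally show ?case .
  qed
  have cons': "G (k + j) s = G k s" if "s \<in> T k" for k j s
    using that by (induction j) (auto simp: cons T_def)
  \<comment> \<open>The index is large enough for s to lie in the region where this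
    \<open>G k\<close> is meaningful; any larger index gives the same value.\<close>
  define g where "g s = G (nat \<lceil>- Re s\<rceil>) s" for s
  have gG: "g s = G k s" if "s \<in> T k" for k s
  proof -
    let ?k = "nat \<lceil>- Re s\<rceil>"
    have "s \<in> T ?k" unfolding T_def mem_Collect_eq by linarith
    from cons'[OF this, of k] cons'[OF that, of ?k] show ?thesis by (simp add: g_def add.commute)
  qed
  have mero: "G k meromorphic_on T k" for k
  proof (induction k)
    case 0
    show ?case unfolding G0 T_def using f
      by (intro analytic_on_imp_meromorphic_on) (simp add: analytic_on_open open_halfspace_Re_gt)
  next
    case (Suc k)
    have sh: "(\<lambda>s. G k (s + a)) meromorphic_on T (Suc k)" if "Re a \<ge> 1" for a
      by (rule meromorphic_on_compose[OF Suc.IH]) (use that in \<open>auto intro!: analytic_intros simp: T_def\<close>)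
    have "(\<lambda>s. G k (s + 1)) meromorphic_on T (Suc k)" "(\<lambda>s. G k (s + 2)) meromorphic_on T (Suc k)"
      "(\<lambda>s. G k (s + 3)) meromorphic_on T (Suc k)"
      by (rule sh; simp)+
    moreover have "c1 meromorphic_on T (Suc k)" "c2 meromorphic_on T (Suc k)" "c3 meromorphic_on T (Suc k)" "P meromorphic_on T (Suc k)"
      using an by (auto intro!: analytic_on_imp_meromorphic_on intro: analytic_on_subset)
    ultimately show ?case unfolding GS
      by (intro meromorphic_on_divide meromorphic_on_uminus meromorphic_on_add meromorphic_on_mult)
  qed
  have ana: "G k analytic_on {s}" if "s \<in> T k" "s \<notin> Z" for k s
    using that
  proof (induction k arbitrary: s)
    case 0
    have "f analytic_on {s. Re s > -1}" using f by (simp add: analytic_on_open open_halfspace_Re_gt)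
    then show ?case unfolding G0 by (rule analytic_on_subset) (use 0 in \<open>auto simp: T_def\<close>)
  next
    case (Suc k)
    have sh: "(\<lambda>s. G k (s + a)) analytic_on {s}" if "a \<in> {1, 2, 3}" for a
    proof (rule analytic_on_compose_gen[of "\<lambda>s. s + a" _ "G k" "{s + a}", unfolded o_def])
      have "s + a \<in> T k" using that Suc.prems by (auto simp: T_def)
      moreover have "s + a \<notin> Z" using that Zs[OF Suc.prems(2)] by auto
      ultimately show "G k analytic_on {s + a}" by (rule Suc.IH)
    qed (auto intro!: analytic_intros)
    have "(\<lambda>s. G k (s + 1)) analytic_on {s}" "(\<lambda>s. G k (s + 2)) analytic_on {s}"
      "(\<lambda>s. G k (s + 3)) analytic_on {s}"
      by (rule sh; simp)+
    moreover have "c1 analytic_on {s}" "c2 analytic_on {s}" "c3 analytic_on {s}" "P analytic_on {s}"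
      using an by (auto intro: analytic_on_subset)
    moreover have "P s \<noteq> 0" using P(2) Suc.prems by blast
    ultimately show ?case unfolding GS
      by (intro analytic_on_divide analytic_on_neg analytic_on_add analytic_on_mult) auto
  qed
  have near: "eventually (\<lambda>w. g w = G k w) (nhds s)" if "s \<in> T k" for s k
    using eventually_nhds_in_open[OF opT that] by eventually_elim (rule gG)
  have ex: "\<exists>k. s \<in> T k" for s
  proof
    show "s \<in> T (nat \<lceil>- Re s\<rceil>)" unfolding T_def mem_Collect_eq by linarith
  qed
  show ?thesis
  proof
    show "g meromorphic_on UNIV"
      unfolding meromorphic_on_meromorphic_at[of g UNIV]
    proof
      fix s :: complex
      obtain k where k: "s \<in> T k" using ex by blast
      have "G k meromorphic_on {s}" using mero[of k] k by (auto intro: meromorphic_on_subset)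
      moreover have "eventually (\<lambda>w. g w = G k w) (at s)" using near[OF k] by (rule eventually_nhds_conv_at[THEN iffD1, THEN conjunct1])
      ultimately show "g meromorphic_on {s}" by (subst meromorphic_on_cong[of "{s}" g "G k" "{s}"]) auto
    qed
    show "g s = f s" if "Re s > -1" for s using gG[of s 0] that by (simp add: G0 T_def)
    show "g analytic_on {s}" if "s \<notin> Z" for s
    proof -
      obtain k where k: "s \<in> T k" using ex by blast
      show ?thesis using analytic_at_cong[OF near[OF k] refl] ana[OF k that] by blast
    qed
    show "P s * g s + c1 s * g (s + 1) + c2 s * g (s + 2) + c3 s * g (s + 3) = 0" if "s \<notin> Z" for s
    proof -
      obtain k where k: "s \<in> T k" using ex by blast
      then have k': "s \<in> T (Suc k)" "s + 1 \<in> T k" "s + 2 \<in> T k" "s + 3 \<in> T k" by (auto simp: T_def)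
      have "P s \<noteq> 0" using P(2) that by blast
      then show ?thesis
        unfolding gG[OF k'(1)] gG[OF k'(2)] gG[OF k'(3)] gG[OF k'(4)] GS by (simp add: field_simps)
    qed
  qed
qed

text \<open>The difference need not be nicely meromorphic at a common pole, so the identity theorem
  is applied to \<open>remove_sings d\<close>. It gives f = g on a punctured neighbourhood of every
  w, and niceness recovers the value at w from there: 0 at a pole, the limit otherwise.\<close>

lemma nicely_meromorphic_eqI:
  assumes f: "f nicely_meromorphic_on UNIV" and g: "g nicely_meromorphic_on UNIV"
    and U: "open U" "z \<in> U" "\<And>w. w \<in> U \<Longrightarrow> f w = g w"
  shows "f = g"
proof
  fix w
  define d where "d s = f s - g s" for s
  have mero: "d meromorphic_on UNIV"
    unfolding d_def using f g by (auto intro!: meromorphic_intros simp: nicely_meromorphic_on_def)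
  have 1: "remove_sings d w = 0" if "w \<in> U" for w
  proof -
    have ev: "eventually (\<lambda>x. d x = 0) (nhds w)"
      using eventually_nhds_in_open[OF U(1) that] by eventually_elim (simp add: d_def U(3))
    then have "d analytic_on {w}" by (subst analytic_at_cong[OF ev refl]) auto
    then show ?thesis using U(3)[OF that] by (simp add: d_def)
  qed
  have "eventually (\<lambda>x. remove_sings d x = 0) (at z)"
    using eventually_at_in_open'[OF U(1,2)] by eventually_elim (rule 1)
  then have "frequently (\<lambda>x. remove_sings d x = 0) (at z)"
    by (rule eventually_frequently[rotated]) simp
  then have 0: "remove_sings d x = 0" for x
    by (rule frequently_eq_meromorphic_imp_constant[OF _ remove_sings_nicely_meromorphic[OF mero]]) auto
  have "eventually (\<lambda>x. remove_sings d x = d x) (at w)"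
    using meromorphic_on_subset[OF mero, of "{w}"]
    by (intro eventually_remove_sings_eq_at meromorphic_on_isolated_singularity) auto
  then have ev: "eventually (\<lambda>x. f x = g x) (at w)"
    by eventually_elim (simp add: 0, simp add: d_def)
  have pole: "is_pole f w \<longleftrightarrow> is_pole g w" using ev by (intro is_pole_cong) auto
  have lim: "(f \<longlongrightarrow> c) (at w) \<longleftrightarrow> (g \<longlongrightarrow> c) (at w)" for c using ev by (intro tendsto_cong)
  have np: "\<not> is_pole h w" if "(h \<longlongrightarrow> c) (at w)" for h :: "complex \<Rightarrow> complex" and c
    using that not_tendsto_and_filterlim_at_infinity[of "at w" h c] by (auto simp: is_pole_def)
  show "f w = g w"
    using f g pole lim np tendsto_unique[of "at w" f "f w" "g w"]
    unfolding nicely_meromorphic_on_def by (metis UNIV_I at_neq_bot)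
qed

text \<open>Shows that the description in \<open>I_def\<close> has exactly one solution:
  \<open>remove_sings F\<close> satisfies it, and agreement on Re s > -1 forces uniqueness. Where F
  is analytic, \<open>remove_sings\<close> leaves its value unchanged.\<close>

lemma I_eq_continuation:
  fixes n m :: nat
  assumes g: "g meromorphic_on UNIV" and an: "\<And>s. Re s > -1 \<Longrightarrow> g analytic_on {s}"
    and eq: "\<And>s. Re s > -1 \<Longrightarrow> Gamma (of_nat n / 2 + s + 1) / Gamma (of_nat n / 2) * g s = I_integral n m s"
    and s: "g analytic_on {s}" "of_nat n / 2 + s + 1 \<notin> \<int>\<^sub>\<le>\<^sub>0"
  shows "I n m s = Gamma (of_nat n / 2 + s + 1) / Gamma (of_nat n / 2) * g s"
proof -
  define F where "F s = Gamma (of_nat n / 2 + s + 1) / Gamma (of_nat n / 2) * g s" for s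
  have Fan: "F analytic_on {s}" if "g analytic_on {s}" "of_nat n / 2 + s + 1 \<notin> \<int>\<^sub>\<le>\<^sub>0" for s
  proof (cases "Gamma (of_nat n / 2 :: complex) = 0")
    case False
    then show ?thesis unfolding F_def using that by (auto intro!: analytic_intros)
  next
    \<comment> \<open>This happens only for n = 0, where \<open>Gamma\<close> is 0 by convention and
      so is the quotient.\<close>
    case True
    then have "F = (\<lambda>_. 0)" by (simp add: F_def fun_eq_iff)
    then show ?thesis by simp
  qed
  have "(\<lambda>s. Gamma (of_nat n / 2 + s + 1) :: complex) meromorphic_on UNIV"
    unfolding Gamma_def
    by (rule meromorphic_on_inverse, rule analytic_on_imp_meromorphic_on) (auto intro!: analytic_intros)
  then have Fm: "F meromorphic_on UNIV"
    unfolding F_def using g by (auto intro!: meromorphic_intros)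
  have nonpole: "of_nat n / 2 + s + 1 \<notin> \<int>\<^sub>\<le>\<^sub>0" if "Re s > -1" for s :: complex
  proof
    assume "of_nat n / 2 + s + 1 \<in> \<int>\<^sub>\<le>\<^sub>0"
    then obtain k :: nat where "of_nat n / 2 + s + 1 = - of_nat k" by (auto elim: nonpos_Ints_cases')
    then have "Re (of_nat n / 2 + s + 1) = - real k" by simp
    then show False using that by simp
  qed
  let ?Q = "\<lambda>f. f nicely_meromorphic_on UNIV \<and> (\<forall>s. Re s > -1 \<longrightarrow> f s = I_integral n m s)"
  have R: "?Q (remove_sings F)"
  proof (intro conjI allI impI)
    show "remove_sings F nicely_meromorphic_on UNIV" by (rule remove_sings_nicely_meromorphic[OF Fm])
    fix s :: complex assume s: "Re s > -1"
    then have "F analytic_on {s}" by (intro Fan an nonpole)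
    then show "remove_sings F s = I_integral n m s" using eq[OF s] by (simp add: F_def)
  qed
  have "I n m = remove_sings F"
    unfolding I_def
  proof (rule the_equality[of ?Q, OF R])
    fix h assume h: "?Q h"
    show "h = remove_sings F"
    proof (rule nicely_meromorphic_eqI)
      show "open {s. Re s > -1}" by (rule open_halfspace_Re_gt)
      show "(0::complex) \<in> {s. Re s > -1}" by simp
    qed (use h R in auto)
  qed
  then show ?thesis using Fan[OF s] by (simp add: F_def)
qed

section \<open>The limiting recurrence\<close>

text \<open>The divisor m^j belongs to the shift by j, because the moments at s + j are to be scaled
  by m^(s+j+1). A constant loses against m and a quadratic against m^3; only the shift by 2 meets
  its exact order.\<close>

lemma rec_coeff_limits:
  fixes p s :: real
  shows "(\<lambda>m. rec1 p s / real m) \<longlonglongrightarrow> 0"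
    "(\<lambda>m. rec2 p (real m) s / real m ^ 2) \<longlonglongrightarrow> - (s + 3 + 2 * p)"
    "(\<lambda>m. rec3 p (real m) s / real m ^ 3) \<longlonglongrightarrow> 0"
proof -
  have x: "(\<lambda>m. 1 / real m) \<longlonglongrightarrow> 0" by (rule lim_1_over_n)
  show "(\<lambda>m. rec1 p s / real m) \<longlonglongrightarrow> 0"
    using tendsto_mult[OF tendsto_const[of "rec1 p s"] x] by simp
  \<comment> \<open>R2 and R3 are the quotients as polynomials in x = 1/m, obtained by giving one
    factor x to each factor that is linear in m. The limits are their values at 0; in R2 the terms 2
    p cancel there.\<close>
  define R2 where "R2 x = ((s + 4 + 3 * p) * x - 1) * ((s + 4 + 2 * p) * (s + 3) * x + (s + 3 + 2 * p) * (1 + (p + s + 3) * x) - 2 * p)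
     + (s + 3 + 4 * p) * x * ((s + 3 + 2 * p) * (1 + (p + s + 3) * x) - 2 * p)
     - 2 * p * (1 + (p + 2 * s + 6) * x)" for x
  define R3 where "R3 x = x * (((s + 4 + 3 * p) * x - 1) * (2 * p - (s + 4 + 2 * p) * (1 + (p + s + 4) * x))
     + 2 * p * (1 + (p + s + 4) * x))" for x
  have e: "rec2 p (real m) s / real m ^ 2 = R2 (1 / real m)" "rec3 p (real m) s / real m ^ 3 = R3 (1 / real m)"
    if "m > 0" for m
  proof -
    define x where "x = 1 / real m"
    have x: "x \<noteq> 0" "real m = 1 / x" using that by (auto simp: x_def)
    have "rec2 p (1 / x) s / (1 / x) ^ 2 = R2 x"
    proof -
      have "1 / (1 / x) ^ 2 = x * x" by (simp add: power2_eq_square)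
      then have "rec2 p (1 / x) s / (1 / x) ^ 2 = rec2 p (1 / x) s * (x * x)" by (metis mult.right_neutral times_divide_eq_right)
      also have "\<dots> = ((s + 4 + 3 * p - 1 / x) * x) * (((s + 4 + 2 * p) * (s + 3) + (s + 3 + 2 * p) * (1 / x + p + s + 3) - 2 * (1 / x) * p) * x)
         + (s + 3 + 4 * p) * x * (((s + 3 + 2 * p) * (1 / x + p + s + 3) - 2 * (1 / x) * p) * x)
         - (2 * (1 / x) * p * x) * ((1 / x + p + 2 * s + 6) * x)"
        unfolding rec2_def by (simp only: ring_distribs mult_ac)
      also have "(s + 4 + 3 * p - 1 / x) * x = (s + 4 + 3 * p) * x - 1" using x(1) by (simp add: left_diff_distrib)
      also have "((s + 4 + 2 * p) * (s + 3) + (s + 3 + 2 * p) * (1 / x + p + s + 3) - 2 * (1 / x) * p) * x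
        = (s + 4 + 2 * p) * (s + 3) * x + (s + 3 + 2 * p) * (1 + (p + s + 3) * x) - 2 * p"
        using x(1) by (simp add: field_simps)
      also have "((s + 3 + 2 * p) * (1 / x + p + s + 3) - 2 * (1 / x) * p) * x = (s + 3 + 2 * p) * (1 + (p + s + 3) * x) - 2 * p"
        using x(1) by (simp add: field_simps)
      also have "2 * (1 / x) * p * x = 2 * p" using x(1) by simp
      also have "(1 / x + p + 2 * s + 6) * x = 1 + (p + 2 * s + 6) * x" using x(1) by (simp add: field_simps)
      finally show ?thesis unfolding R2_def .
    qed
    moreover have "rec3 p (1 / x) s / (1 / x) ^ 3 = R3 x"
    proof -
      have "1 / (1 / x) ^ 3 = x * (x * x)" by (simp add: power3_eq_cube)
      then have "rec3 p (1 / x) s / (1 / x) ^ 3 = rec3 p (1 / x) s * (x * (x * x))" by (metis mult.right_neutral times_divide_eq_right)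
      also have "\<dots> = x * (((s + 4 + 3 * p - 1 / x) * x) * ((2 * (1 / x) * p - (s + 4 + 2 * p) * (1 / x + p + s + 4)) * x)
         + (2 * (1 / x) * p * x) * ((1 / x + p + s + 4) * x))"
        unfolding rec3_def by (simp only: ring_distribs mult_ac)
      also have "(s + 4 + 3 * p - 1 / x) * x = (s + 4 + 3 * p) * x - 1" using x(1) by (simp add: left_diff_distrib)
      also have "(2 * (1 / x) * p - (s + 4 + 2 * p) * (1 / x + p + s + 4)) * x = 2 * p - (s + 4 + 2 * p) * (1 + (p + s + 4) * x)"
        using x(1) by (simp add: field_simps)
      also have "2 * (1 / x) * p * x = 2 * p" using x(1) by simp
      also have "(1 / x + p + s + 4) * x = 1 + (p + s + 4) * x" using x(1) by (simp add: field_simps)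
      finally show ?thesis unfolding R3_def .
    qed
    ultimately show "rec2 p (real m) s / real m ^ 2 = R2 (1 / real m)" "rec3 p (real m) s / real m ^ 3 = R3 (1 / real m)"
      unfolding x(2) by simp_all
  qed
  have c: "isCont R2 0" "isCont R3 0" unfolding R2_def R3_def by (intro continuous_intros)+
  have "(\<lambda>m. R2 (1 / real m)) \<longlonglongrightarrow> R2 0" "(\<lambda>m. R3 (1 / real m)) \<longlonglongrightarrow> R3 0"
    using isCont_tendsto_compose[OF c(1) x] isCont_tendsto_compose[OF c(2) x] .
  moreover have "\<forall>\<^sub>F m in sequentially. rec2 p (real m) s / real m ^ 2 = R2 (1 / real m)"
     "\<forall>\<^sub>F m in sequentially. rec3 p (real m) s / real m ^ 3 = R3 (1 / real m)"
    using eventually_gt_at_top[of 0] by (eventually_elim, simp add: e)+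
  ultimately show "(\<lambda>m. rec2 p (real m) s / real m ^ 2) \<longlonglongrightarrow> - (s + 3 + 2 * p)"
    "(\<lambda>m. rec3 p (real m) s / real m ^ 3) \<longlonglongrightarrow> 0"
    by (simp_all add: tendsto_cong R2_def R3_def)
qed

text \<open>Bounded scaled terms suffice, since their coefficients tend to 0 after the limit of the
  second one is split off. It is used twice: over the reals, with boundedness from the squeeze, and
  over the complex numbers, with boundedness from limits already known further right.\<close>

lemma scaled_recurrence_limit:
  fixes y :: "nat \<Rightarrow> nat \<Rightarrow> 'a::real_normed_field" and p s :: real
  assumes rec: "\<And>m. m \<ge> 1 \<Longrightarrow> of_real (rec0 p s) * y 0 m + of_real (rec1 p s) * y 1 m
      + of_real (rec2 p (real m) s * (s + 2)) * y 2 m + of_real (rec3 p (real m) s * (s + 2) * (s + 3)) * y 3 m = 0"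
    and B: "\<And>j. j \<in> {1, 2, 3} \<Longrightarrow> Bseq (\<lambda>m. of_real (real m powr (s + real j + 1)) * y j m)"
  shows "(\<lambda>m. of_real (rec0 p s) * (of_real (real m powr (s + 1)) * y 0 m)
     - of_real ((s + 3 + 2 * p) * (s + 2)) * (of_real (real m powr (s + 2 + 1)) * y 2 m)) \<longlonglongrightarrow> 0"
proof -
  define a where "a j m = of_real (real m powr (s + real j + 1)) * y j m" for j m
  have z: "(\<lambda>m. of_real (c m) * a j m) \<longlonglongrightarrow> 0" if "c \<longlonglongrightarrow> 0" "j \<in> {1, 2, 3}" for c :: "nat \<Rightarrow> real" and j
  proof -
    have "Zfun (\<lambda>m. of_real (c m) :: 'a) sequentially"
      using tendsto_of_real[OF that(1), where 'a = 'a] by (simp add: tendsto_Zfun_iff)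
    then have "Zfun (\<lambda>m. of_real (c m) * a j m) sequentially"
      using B[OF that(2)] unfolding a_def[abs_def] by (rule bounded_bilinear.Zfun_prod_Bfun[OF bounded_bilinear_mult])
    then show ?thesis by (simp add: tendsto_Zfun_iff)
  qed
  have "(\<lambda>m. rec1 p s / real m) \<longlonglongrightarrow> 0" by (rule rec_coeff_limits)
  moreover have "(\<lambda>m. (rec2 p (real m) s / real m ^ 2 + (s + 3 + 2 * p)) * (s + 2)) \<longlonglongrightarrow> (- (s + 3 + 2 * p) + (s + 3 + 2 * p)) * (s + 2)"
    by (intro tendsto_intros rec_coeff_limits)
  then have "(\<lambda>m. (rec2 p (real m) s / real m ^ 2 + (s + 3 + 2 * p)) * (s + 2)) \<longlonglongrightarrow> 0" by simp
  moreover have "(\<lambda>m. rec3 p (real m) s / real m ^ 3 * ((s + 2) * (s + 3))) \<longlonglongrightarrow> 0 * ((s + 2) * (s + 3))"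
    by (intro tendsto_intros rec_coeff_limits)
  then have "(\<lambda>m. rec3 p (real m) s / real m ^ 3 * ((s + 2) * (s + 3))) \<longlonglongrightarrow> 0" by simp
  ultimately have "(\<lambda>m. - (of_real (rec1 p s / real m) * a 1 m)
      - of_real ((rec2 p (real m) s / real m ^ 2 + (s + 3 + 2 * p)) * (s + 2)) * a 2 m
      - of_real (rec3 p (real m) s / real m ^ 3 * ((s + 2) * (s + 3))) * a 3 m) \<longlonglongrightarrow> - 0 - 0 - 0"
    by (intro tendsto_diff tendsto_minus z) auto
  moreover have "\<forall>\<^sub>F m in sequentially. - (of_real (rec1 p s / real m) * a 1 m)
      - of_real ((rec2 p (real m) s / real m ^ 2 + (s + 3 + 2 * p)) * (s + 2)) * a 2 m
      - of_real (rec3 p (real m) s / real m ^ 3 * ((s + 2) * (s + 3))) * a 3 m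
     = of_real (rec0 p s) * (of_real (real m powr (s + 1)) * y 0 m)
     - of_real ((s + 3 + 2 * p) * (s + 2)) * (of_real (real m powr (s + 2 + 1)) * y 2 m)"
    using eventually_ge_at_top[of 1]
  proof eventually_elim
    case (elim m)
    define w :: 'a where "w = of_real (real m powr (s + 1))"
    define M :: 'a where "M = of_nat m"
    have M: "M \<noteq> 0" using elim by (simp add: M_def)
    have a: "a j m = w * M ^ j * y j m" for j
    proof -
      have "real m powr (s + real j + 1) = real m powr (s + 1) * real m ^ j"
        using elim by (simp add: powr_add powr_realpow mult_ac)
      then show ?thesis by (simp add: a_def w_def M_def)
    qed
    have c: "of_real (x / real m ^ k * c) * (w * M ^ k * z) = w * (of_real (x * c) * z)" for x c k z
      using M by (simp add: M_def)
    have w2: "of_real (real m powr (s + 2 + 1)) * y 2 m = a 2 m" by (simp add: a_def)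
    have "0 = w * (of_real (rec0 p s) * y 0 m + of_real (rec1 p s) * y 1 m
      + of_real (rec2 p (real m) s * (s + 2)) * y 2 m + of_real (rec3 p (real m) s * (s + 2) * (s + 3)) * y 3 m)"
      using rec[OF elim] by simp
    also have "\<dots> = of_real (rec0 p s) * (w * y 0 m) + of_real (rec1 p s / real m) * a 1 m
      + of_real (rec2 p (real m) s / real m ^ 2 * (s + 2)) * a 2 m
      + of_real (rec3 p (real m) s / real m ^ 3 * ((s + 2) * (s + 3))) * a 3 m"
      using c[of "rec1 p s" 1 1] c[of "rec2 p (real m) s" 2 "s + 2"] c[of "rec3 p (real m) s" 3 "(s + 2) * (s + 3)"]
      unfolding a by (simp only: ring_distribs power_one_right mult.right_neutral mult.assoc) (simp only: mult_ac)
    finally show ?case unfolding w2 w_def[symmetric]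
      by (simp add: ring_distribs add_eq_0_iff)
  qed
  ultimately show ?thesis by (simp add: filterlim_cong[OF refl refl])
qed

section \<open>Squeezing the moments\<close>

definition S_factor :: "real \<Rightarrow> nat \<Rightarrow> real" where
  "S_factor p m = pochhammer (2 * p + 1) m / pochhammer (p + 1) m"

text \<open>For p = n/2 - 1 this is I_m(s) without the factor Gamma(n/2 + s + 1) /
  Gamma(n/2).\<close>

definition S_moment :: "real \<Rightarrow> nat \<Rightarrow> real \<Rightarrow> real" where
  "S_moment p m s = (S_factor p m)\<^sup>2 * rGamma (s + 1) *
     integral {0..1} (\<lambda>t. Jacobi_weight (real m + p) s t * (hyp2F1 (real m) (-p) (real m + p + 1) t)\<^sup>2)"

text \<open>The asserted limit without that factor. The last three pairs grow like s^(2p),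
  (s/2)^(-p) and (s/2)^p, so the whole grows like s^(2p).\<close>

definition lim_moment :: "real \<Rightarrow> real \<Rightarrow> real" where
  "lim_moment p s = (Gamma (p + 1))\<^sup>2 * (rGamma (2 * p + 1))\<^sup>2 *
     (Gamma (s + 4 * p + 3) * rGamma (s + 2 * p + 3)) *
     (Gamma (s / 2 + p + 2) * rGamma (s / 2 + 2 * p + 2)) *
     (Gamma (s / 2 + p + 1) * rGamma (s / 2 + 1))"

text \<open>The limit in m of the scaled moment when F is replaced by (1 - t)^p.\<close>

definition lower_moment :: "real \<Rightarrow> real \<Rightarrow> real" where
  "lower_moment p s = (Gamma (p + 1) / Gamma (2 * p + 1))\<^sup>2 * rGamma (s + 1) * Gamma (s + 2 * p + 1)"

text \<open>The same limit when F is replaced by the sum in \<open>hyp2F1_le_sum\<close>, squared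
  and multiplied out.\<close>

definition upper_moment :: "real \<Rightarrow> nat \<Rightarrow> real \<Rightarrow> real" where
  "upper_moment p N s = (Gamma (p + 1) / Gamma (2 * p + 1))\<^sup>2 * rGamma (s + 1) *
     (\<Sum>i\<le>N. \<Sum>j\<le>N. real (N choose i) * pochhammer (p + 1) i * (real (N choose j) * pochhammer (p + 1) j) *
       Gamma (s + 2 * p + 1 - real (i + j)))"

lemma pochhammer_eq_Gamma_ratio:
  fixes a :: real
  assumes "a > 0"
  shows "pochhammer a k = Gamma (a + real k) / Gamma a"
proof -
  have "a \<notin> \<int>\<^sub>\<le>\<^sub>0" using assms by (auto elim!: nonpos_Ints_cases)
  then show ?thesis by (rule pochhammer_Gamma)
qed

lemma S_factor_asymp:
  assumes "p > 0"
  shows "(\<lambda>m. S_factor p m * real m powr (-p)) \<longlonglongrightarrow> Gamma (p + 1) / Gamma (2 * p + 1)"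
proof -
  have "(\<lambda>m. Gamma (p + 1) / Gamma (2 * p + 1) *
      (Gamma (2 * p + 1 + real m) / Gamma (p + 1 + real m) * real m powr (p + 1 - (2 * p + 1)))) \<longlonglongrightarrow> Gamma (p + 1) / Gamma (2 * p + 1) * 1"
    by (intro tendsto_mult tendsto_const Gamma_ratio_asymp) (use assms in auto)
  then show ?thesis using assms by (simp add: S_factor_def pochhammer_eq_Gamma_ratio mult_ac)
qed

lemma pochhammer_shift_asymp:
  assumes "p > 0"
  shows "(\<lambda>m. real m ^ i / pochhammer (real m + p + 1) i) \<longlonglongrightarrow> 1"
proof -
  have "(\<lambda>m. Gamma (p + 1 + real m) / Gamma (p + 1 + real i + real m) * real m powr (p + 1 + real i - (p + 1))) \<longlonglongrightarrow> 1"
    by (intro Gamma_ratio_asymp) (use assms in auto)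
  moreover have "\<forall>\<^sub>F m in sequentially. Gamma (p + 1 + real m) / Gamma (p + 1 + real i + real m) * real m powr (p + 1 + real i - (p + 1))
      = real m ^ i / pochhammer (real m + p + 1) i"
    using eventually_gt_at_top[of 0]
  proof eventually_elim
    case (elim m)
    have "pochhammer (real m + p + 1) i = Gamma (p + 1 + real i + real m) / Gamma (p + 1 + real m)"
      using assms pochhammer_eq_Gamma_ratio[of "real m + p + 1" i] by (simp add: ac_simps)
    then show ?case using elim by (simp add: powr_realpow)
  qed
  ultimately show ?thesis by (simp add: filterlim_cong[OF refl refl])
qed

lemma Beta_scaled_asymp:
  fixes z :: real
  assumes "p > 0" "z > 0"
  shows "(\<lambda>m. real m powr z * Beta (real m + p + 1) z) \<longlonglongrightarrow> Gamma z"
proof -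
  have "(\<lambda>m. Gamma z * (Gamma (p + 1 + real m) / Gamma (p + 1 + z + real m) * real m powr (p + 1 + z - (p + 1)))) \<longlonglongrightarrow> Gamma z * 1"
    by (intro tendsto_mult tendsto_const Gamma_ratio_asymp) (use assms in auto)
  then show ?thesis by (simp add: Beta_def ac_simps)
qed

lemma Jacobi_weight_has_integral:
  assumes "q > -1" "\<sigma> > -1"
  shows "(Jacobi_weight q \<sigma> has_integral Beta (q + 1) (\<sigma> + 1)) {0..1}"
  using has_integral_Beta_real[of "q + 1" "\<sigma> + 1"] assms unfolding Jacobi_weight_def[abs_def] by simp

lemma Jacobi_weight_mult_powr: "Jacobi_weight q \<sigma> t * (1 - t) powr a = Jacobi_weight q (\<sigma> + a) t"
  by (simp add: Jacobi_weight_def powr_add)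

context
  fixes p s :: real and N :: nat
  assumes p: "p > 0" and N: "p \<le> real N" and s: "s > 4" "s > 2 * real N - 2 * p - 1"
begin

text \<open>The scaled integral of (1 - t)^(s + 2p - k), of exact order m^k. Its companion
  \<open>e m i\<close> has order m^(-i). The context assumption s > 2 N - 2 p - 1 makes even the
  most singular exponent, at k = 2 N, integrable.\<close>

private definition "b m k = real m powr (s + 1) * ((S_factor p m)\<^sup>2 * rGamma (s + 1)) *
   Beta (real m + p + 1) (s + 2 * p + 1 - real k)"

private definition "e m i = real (N choose i) * (pochhammer (p + 1) i / pochhammer (real m + p + 1) i)"

private lemma rG: "rGamma (s + 1) > 0"
  using s(1) by (simp add: rGamma_inverse_Gamma Gamma_real_pos)

private lemma lower:
  assumes m: "m \<ge> 1"
  shows "b m 0 \<le> real m powr (s + 1) * S_moment p m s"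
proof -
  let ?H = "hyp2F1 (real m) (-p) (real m + p + 1)" and ?W = "Jacobi_weight (real m + p) s"
  have "((\<lambda>t. Jacobi_weight (real m + p) (s + 2 * p) t) has_integral Beta (real m + p + 1) (s + 2 * p + 1)) {0..1}"
    by (rule Jacobi_weight_has_integral) (use p s in auto)
  then have "Beta (real m + p + 1) (s + 2 * p + 1) \<le> integral {0..1} (\<lambda>t. ?W t * (?H t)\<^sup>2)"
  proof (rule has_integral_le[OF _ integrable_integral[OF moment_integrable[OF m p s(1)]]])
    fix t :: real assume t: "t \<in> {0..1}"
    show "Jacobi_weight (real m + p) (s + 2 * p) t \<le> ?W t * (?H t)\<^sup>2"
    \<comment> \<open>The bounds on F need t < 1; at t = 1 both weights are 0 because
      \<open>0 powr x = 0\<close>.\<close>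
    proof (cases "t = 1")
      case False
      have "((1 - t) powr p)\<^sup>2 \<le> (?H t)\<^sup>2"
        using hyp2F1_ge_powr[OF m p, of t] t False by (intro power_mono) auto
      also have "((1 - t) powr p)\<^sup>2 = (1 - t) powr (2 * p)"
        by (simp add: power2_eq_square powr_add[symmetric])
      finally have "?W t * (1 - t) powr (2 * p) \<le> ?W t * (?H t)\<^sup>2"
        by (intro mult_left_mono) (auto simp: Jacobi_weight_def)
      then show ?thesis by (simp only: Jacobi_weight_mult_powr)
    qed (simp add: Jacobi_weight_def)
  qed
  then show ?thesis unfolding b_def S_moment_def mult.assoc using rG
    by (intro mult_left_mono) auto
qed

private lemma upper:
  assumes m: "m \<ge> 1"
  shows "real m powr (s + 1) * S_moment p m s \<le> (\<Sum>i\<le>N. \<Sum>j\<le>N. e m i * e m j * b m (i + j))"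
proof -
  let ?H = "hyp2F1 (real m) (-p) (real m + p + 1)" and ?W = "Jacobi_weight (real m + p) s"
  have "((\<lambda>t. \<Sum>i\<le>N. \<Sum>j\<le>N. e m i * e m j * Jacobi_weight (real m + p) (s + 2 * p - real (i + j)) t) has_integral
     (\<Sum>i\<le>N. \<Sum>j\<le>N. e m i * e m j * Beta (real m + p + 1) (s + 2 * p - real (i + j) + 1))) {0..1}"
    by (intro has_integral_sum has_integral_mult_right Jacobi_weight_has_integral) (use p s in auto)
  then have "integral {0..1} (\<lambda>t. ?W t * (?H t)\<^sup>2) \<le> (\<Sum>i\<le>N. \<Sum>j\<le>N. e m i * e m j * Beta (real m + p + 1) (s + 2 * p - real (i + j) + 1))"
  proof (rule has_integral_le[OF integrable_integral[OF moment_integrable[OF m p s(1)]]])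
    fix t :: real assume t: "t \<in> {0..1}"
    show "?W t * (?H t)\<^sup>2 \<le> (\<Sum>i\<le>N. \<Sum>j\<le>N. e m i * e m j * Jacobi_weight (real m + p) (s + 2 * p - real (i + j)) t)"
    proof (cases "t = 1")
      case False
      \<comment> \<open>Squaring the upper bound requires F >= 0, which the lower bound
        supplies.\<close>
      have "0 \<le> (1 - t) powr p" by simp
      also have "\<dots> \<le> ?H t" using hyp2F1_ge_powr[OF m p, of t] t False by auto
      finally have "(?H t)\<^sup>2 \<le> (\<Sum>i\<le>N. e m i * (1 - t) powr (p - real i))\<^sup>2"
        using hyp2F1_le_sum[OF m p _ _ N, of t] t False unfolding e_def by (intro power_mono) auto
      also have "\<dots> = (\<Sum>i\<le>N. \<Sum>j\<le>N. e m i * e m j * (1 - t) powr (2 * p - real (i + j)))"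
        unfolding power2_eq_square sum_product
      proof (intro sum.cong refl)
        fix i j
        have "(1 - t) powr (p - real i) * (1 - t) powr (p - real j) = (1 - t) powr (2 * p - real (i + j))"
          by (simp only: powr_add[symmetric]) (simp add: algebra_simps)
        then show "e m i * (1 - t) powr (p - real i) * (e m j * (1 - t) powr (p - real j)) = e m i * e m j * (1 - t) powr (2 * p - real (i + j))"
          by (simp add: mult_ac)
      qed
      finally have "?W t * (?H t)\<^sup>2 \<le> ?W t * (\<Sum>i\<le>N. \<Sum>j\<le>N. e m i * e m j * (1 - t) powr (2 * p - real (i + j)))"
        by (intro mult_left_mono) (auto simp: Jacobi_weight_def)
      also have "\<dots> = (\<Sum>i\<le>N. \<Sum>j\<le>N. e m i * e m j * (?W t * (1 - t) powr (2 * p - real (i + j))))"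
        by (simp add: sum_distrib_left mult_ac)
      finally show ?thesis by (simp only: Jacobi_weight_mult_powr add_diff_eq)
    qed (simp add: Jacobi_weight_def)
  qed
  then have "real m powr (s + 1) * S_moment p m s \<le> real m powr (s + 1) * ((S_factor p m)\<^sup>2 * rGamma (s + 1) *
       (\<Sum>i\<le>N. \<Sum>j\<le>N. e m i * e m j * Beta (real m + p + 1) (s + 2 * p - real (i + j) + 1)))"
    unfolding S_moment_def using rG by (intro mult_left_mono) auto
  also have "\<dots> = (\<Sum>i\<le>N. \<Sum>j\<le>N. e m i * e m j * b m (i + j))"
    unfolding b_def by (simp add: sum_distrib_left mult_ac diff_add_eq)
  finally show ?thesis .
qed

private lemma b_lim:
  assumes "k \<le> 2 * N"
  shows "(\<lambda>m. b m k / real m ^ k) \<longlonglongrightarrow> (Gamma (p + 1) / Gamma (2 * p + 1))\<^sup>2 * rGamma (s + 1) * Gamma (s + 2 * p + 1 - real k)"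
proof -
  let ?z = "s + 2 * p + 1 - real k"
  have z: "?z > 0" using s(2) assms by linarith
  have "(\<lambda>m. (S_factor p m * real m powr (-p))\<^sup>2 * rGamma (s + 1) * (real m powr ?z * Beta (real m + p + 1) ?z))
     \<longlonglongrightarrow> (Gamma (p + 1) / Gamma (2 * p + 1))\<^sup>2 * rGamma (s + 1) * Gamma ?z"
    by (intro tendsto_mult tendsto_power S_factor_asymp Beta_scaled_asymp tendsto_const p z)
  moreover have "\<forall>\<^sub>F m in sequentially. (S_factor p m * real m powr (-p))\<^sup>2 * rGamma (s + 1) * (real m powr ?z * Beta (real m + p + 1) ?z) = b m k / real m ^ k"
    using eventually_gt_at_top[of 0]
  proof eventually_elim
    case (elim m)
    have "real m powr (s + 1) / real m ^ k = real m powr (s + 1 - real k)"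
      using elim by (simp add: powr_diff powr_realpow)
    also have "\<dots> = real m powr (-p) * real m powr (-p) * real m powr ?z"
      by (simp only: powr_add[symmetric]) (simp add: algebra_simps)
    finally have x: "real m powr (s + 1) / real m ^ k = real m powr (-p) * real m powr (-p) * real m powr ?z" .
    have "b m k / real m ^ k = (real m powr (s + 1) / real m ^ k) * ((S_factor p m)\<^sup>2 * rGamma (s + 1)) * Beta (real m + p + 1) ?z"
      unfolding b_def by (simp only: times_divide_eq_left)
    then have "b m k / real m ^ k = (real m powr (-p) * real m powr (-p) * real m powr ?z) * ((S_factor p m)\<^sup>2 * rGamma (s + 1)) * Beta (real m + p + 1) ?z"
      unfolding x .
    then show ?case by (simp add: power2_eq_square mult_ac)
  qed
  ultimately show ?thesis by (simp add: filterlim_cong[OF refl refl])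
qed

private lemma e_lim: "(\<lambda>m. e m i * real m ^ i) \<longlonglongrightarrow> real (N choose i) * pochhammer (p + 1) i"
proof -
  have "(\<lambda>m. real (N choose i) * pochhammer (p + 1) i * (real m ^ i / pochhammer (real m + p + 1) i)) \<longlonglongrightarrow> real (N choose i) * pochhammer (p + 1) i * 1"
    by (intro tendsto_mult tendsto_const pochhammer_shift_asymp p)
  then show ?thesis by (simp add: e_def)
qed

text \<open>In \<open>e m i * e m j * b m (i + j)\<close> the powers of m cancel, so every term of
  the double sum keeps a finite limit and none drops out at this stage. That is why the two bounding
  limits differ.\<close>

lemma moment_squeeze:
  obtains l u where
    "\<And>m. m \<ge> 1 \<Longrightarrow> l m \<le> real m powr (s + 1) * S_moment p m s"
    "\<And>m. m \<ge> 1 \<Longrightarrow> real m powr (s + 1) * S_moment p m s \<le> u m"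
    "l \<longlonglongrightarrow> lower_moment p s" "u \<longlonglongrightarrow> upper_moment p N s"
proof (rule that[of "\<lambda>m. b m 0" "\<lambda>m. \<Sum>i\<le>N. \<Sum>j\<le>N. e m i * e m j * b m (i + j)"])
  show "(\<lambda>m. b m 0) \<longlonglongrightarrow> lower_moment p s"
    using b_lim[of 0] by (simp add: lower_moment_def)
  let ?E = "\<lambda>i. real (N choose i) * pochhammer (p + 1) i"
  have "(\<lambda>m. \<Sum>i\<le>N. \<Sum>j\<le>N. (e m i * real m ^ i) * (e m j * real m ^ j) * (b m (i + j) / real m ^ (i + j))) \<longlonglongrightarrow>
     (\<Sum>i\<le>N. \<Sum>j\<le>N. ?E i * ?E j * ((Gamma (p + 1) / Gamma (2 * p + 1))\<^sup>2 * rGamma (s + 1) * Gamma (s + 2 * p + 1 - real (i + j))))"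
    by (intro tendsto_sum tendsto_mult e_lim b_lim) auto
  also have "(\<Sum>i\<le>N. \<Sum>j\<le>N. ?E i * ?E j * ((Gamma (p + 1) / Gamma (2 * p + 1))\<^sup>2 * rGamma (s + 1) * Gamma (s + 2 * p + 1 - real (i + j))))
     = (Gamma (p + 1) / Gamma (2 * p + 1))\<^sup>2 * rGamma (s + 1) * (\<Sum>i\<le>N. \<Sum>j\<le>N. ?E i * ?E j * Gamma (s + 2 * p + 1 - real (i + j)))"
    unfolding sum_distrib_left by (intro sum.cong refl) (simp only: mult_ac)
  finally have L: "(\<lambda>m. \<Sum>i\<le>N. \<Sum>j\<le>N. (e m i * real m ^ i) * (e m j * real m ^ j) * (b m (i + j) / real m ^ (i + j))) \<longlonglongrightarrow> \<dots>" .
  have "\<forall>\<^sub>F m in sequentially. (\<Sum>i\<le>N. \<Sum>j\<le>N. (e m i * real m ^ i) * (e m j * real m ^ j) * (b m (i + j) / real m ^ (i + j)))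
     = (\<Sum>i\<le>N. \<Sum>j\<le>N. e m i * e m j * b m (i + j))"
    using eventually_gt_at_top[of 0]
    by eventually_elim (auto intro!: sum.cong simp: power_add)
  then show "(\<lambda>m. \<Sum>i\<le>N. \<Sum>j\<le>N. e m i * e m j * b m (i + j)) \<longlonglongrightarrow> upper_moment p N s"
    unfolding upper_moment_def using L by (rule Lim_transform_eventually[rotated])
qed (use lower upper in auto)

end

section \<open>The asserted limit: its recurrence and its growth in s\<close>

lemma Gamma_plus1_nonzero:
  fixes z :: "'a :: Gamma"
  assumes "z \<noteq> 0"
  shows "Gamma (z + 1) = z * Gamma z"
  \<comment> \<open>As \<open>Gamma\<close> is the inverse of the entire \<open>rGamma\<close>, the
    identity also covers poles, where both sides are 0.\<close>
  using assms unfolding Gamma_def rGamma_plus1[of z, symmetric] by simp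

text \<open>Raising s by 2 moves the arguments in s by two steps and those in s/2 by one, so both
  sides reduce to a polynomial identity. The four hypotheses belong to the \<open>Gamma\<close>
  steps; the \<open>rGamma\<close> steps hold everywhere.\<close>

lemma lim_moment_recurrence:
  assumes "s + 4 * p + 3 \<noteq> 0" "s + 4 * p + 4 \<noteq> 0" "s / 2 + p + 1 \<noteq> 0" "s / 2 + p + 2 \<noteq> 0"
  shows "rec0 p s * lim_moment p s = (s + 3 + 2 * p) * (s + 2) * lim_moment p (s + 2)"
proof -
  have G: "Gamma (s + 2 + 4 * p + 3) = (s + 4 * p + 4) * ((s + 4 * p + 3) * Gamma (s + 4 * p + 3))"
    "Gamma ((s + 2) / 2 + p + 2) = (s / 2 + p + 2) * Gamma (s / 2 + p + 2)"
    "Gamma ((s + 2) / 2 + p + 1) = (s / 2 + p + 1) * Gamma (s / 2 + p + 1)"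
  proof -
    have e: "s + 2 + 4 * p + 3 = (s + 4 * p + 3) + 1 + 1" "(s + 2) / 2 + p + 2 = (s / 2 + p + 2) + 1"
      "(s + 2) / 2 + p + 1 = (s / 2 + p + 1) + 1" by (simp_all add: field_simps)
    have "s + 4 * p + 3 + 1 \<noteq> 0" using assms(2) by simp
    from Gamma_plus1_nonzero[OF this]
    have "Gamma ((s + 4 * p + 3) + 1 + 1) = (s + 4 * p + 3 + 1) * ((s + 4 * p + 3) * Gamma (s + 4 * p + 3))"
      by (simp only: Gamma_plus1_nonzero[OF assms(1)])
    then show "Gamma (s + 2 + 4 * p + 3) = (s + 4 * p + 4) * ((s + 4 * p + 3) * Gamma (s + 4 * p + 3))"
      unfolding e by (simp add: add.assoc)
    show "Gamma ((s + 2) / 2 + p + 2) = (s / 2 + p + 2) * Gamma (s / 2 + p + 2)"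
      unfolding e by (rule Gamma_plus1_nonzero) (rule assms)
    show "Gamma ((s + 2) / 2 + p + 1) = (s / 2 + p + 1) * Gamma (s / 2 + p + 1)"
      unfolding e by (rule Gamma_plus1_nonzero) (rule assms)
  qed
  have R: "rGamma (s + 2 * p + 3) = (s + 2 * p + 3) * ((s + 2 * p + 4) * rGamma (s + 2 + 2 * p + 3))"
    "rGamma (s / 2 + 2 * p + 2) = (s / 2 + 2 * p + 2) * rGamma ((s + 2) / 2 + 2 * p + 2)"
    "rGamma (s / 2 + 1) = (s / 2 + 1) * rGamma ((s + 2) / 2 + 1)"
    using rGamma_plus1[of "s + 2 * p + 3"] rGamma_plus1[of "s + 2 * p + 4"]
      rGamma_plus1[of "s / 2 + 2 * p + 2"] rGamma_plus1[of "s / 2 + 1"]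
    by (simp_all add: add_divide_distrib add_ac)
  \<comment> \<open>Taking \<open>Gamma\<close> at s but \<open>rGamma\<close> at s + 2 makes both
    values of \<open>lim_moment\<close> polynomial multiples of A, without any division.\<close>
  define A where "A = (Gamma (p + 1))\<^sup>2 * (rGamma (2 * p + 1))\<^sup>2 * Gamma (s + 4 * p + 3) * rGamma (s + 2 + 2 * p + 3)
     * Gamma (s / 2 + p + 2) * rGamma ((s + 2) / 2 + 2 * p + 2) * Gamma (s / 2 + p + 1) * rGamma ((s + 2) / 2 + 1)"
  have "lim_moment p s = A * ((s + 2 * p + 3) * (s + 2 * p + 4) * (s / 2 + 2 * p + 2) * (s / 2 + 1))"
    unfolding lim_moment_def A_def R by (simp only: mult_ac)
  moreover have "lim_moment p (s + 2) = A * ((s + 4 * p + 4) * (s + 4 * p + 3) * (s / 2 + p + 2) * (s / 2 + p + 1))"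
    unfolding lim_moment_def A_def G by (simp only: mult_ac)
  moreover have "rec0 p s * ((s + 2 * p + 3) * (s + 2 * p + 4) * (s / 2 + 2 * p + 2) * (s / 2 + 1))
    = (s + 3 + 2 * p) * (s + 2) * ((s + 4 * p + 4) * (s + 4 * p + 3) * (s / 2 + p + 2) * (s / 2 + p + 1))"
  proof -
    have "s / 2 + 2 * p + 2 = (s + 4 * p + 4) / 2" "s / 2 + 1 = (s + 2) / 2" "s / 2 + p + 2 = (s + 2 * p + 4) / 2"
      "s / 2 + p + 1 = (s + 2 * p + 2) / 2" "s + 2 + 2 * p = s + 2 * p + 2" "s + 3 + 4 * p = s + 4 * p + 3"
      "s + 3 + 2 * p = s + 2 * p + 3" by (simp_all add: field_simps)
    then show ?thesis unfolding rec0_def by (simp only: mult_ac times_divide_eq_right times_divide_eq_left)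
  qed
  ultimately show ?thesis by (simp only: mult.left_commute[of _ A])
qed

lemma lim_moment_pos:
  assumes "p > 0" "s > 0"
  shows "lim_moment p s > 0"
  unfolding lim_moment_def rGamma_inverse_Gamma using assms
  by (intro mult_pos_pos zero_less_power positive_imp_inverse_positive Gamma_real_pos) auto

text \<open>The growth (2k)^(2p) comes from the pair in s alone, since the powers of k from the two
  pairs in s/2 cancel. The constant is the one in \<open>lower_moment\<close>, which is what makes
  the squeeze close.\<close>

lemma lim_moment_asymp:
  assumes "p > 0" "s > 0"
  shows "(\<lambda>k. lim_moment p (s + 2 * real k) * (2 * real k) powr (- 2 * p)) \<longlonglongrightarrow> (Gamma (p + 1) / Gamma (2 * p + 1))\<^sup>2"
proof -
  let ?C = "(Gamma (p + 1) / Gamma (2 * p + 1))\<^sup>2"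
  have "(\<lambda>k. ?C * ((Gamma (s + 4 * p + 3 + 2 * real k) / Gamma (s + 2 * p + 3 + 2 * real k) * (2 * real k) powr (s + 2 * p + 3 - (s + 4 * p + 3))) *
     (Gamma (s / 2 + p + 2 + real k) / Gamma (s / 2 + 2 * p + 2 + real k) * real k powr (s / 2 + 2 * p + 2 - (s / 2 + p + 2))) *
     (Gamma (s / 2 + p + 1 + real k) / Gamma (s / 2 + 1 + real k) * real k powr (s / 2 + 1 - (s / 2 + p + 1))))) \<longlonglongrightarrow> ?C * (1 * 1 * 1)"
    by (intro tendsto_mult tendsto_const Gamma_ratio_asymp Gamma_ratio_asymp_even) (use assms in auto)
  moreover have "\<forall>\<^sub>F k in sequentially. ?C * ((Gamma (s + 4 * p + 3 + 2 * real k) / Gamma (s + 2 * p + 3 + 2 * real k) * (2 * real k) powr (s + 2 * p + 3 - (s + 4 * p + 3))) *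
     (Gamma (s / 2 + p + 2 + real k) / Gamma (s / 2 + 2 * p + 2 + real k) * real k powr (s / 2 + 2 * p + 2 - (s / 2 + p + 2))) *
     (Gamma (s / 2 + p + 1 + real k) / Gamma (s / 2 + 1 + real k) * real k powr (s / 2 + 1 - (s / 2 + p + 1))))
     = lim_moment p (s + 2 * real k) * (2 * real k) powr (- 2 * p)"
    using eventually_gt_at_top[of 0]
  proof eventually_elim
    case (elim k)
    have k: "real k powr (s / 2 + 2 * p + 2 - (s / 2 + p + 2)) * real k powr (s / 2 + 1 - (s / 2 + p + 1)) = 1"
      using elim by (simp add: powr_add[symmetric])
    have x: "s + 2 * p + 3 - (s + 4 * p + 3) = - 2 * p" by simp
    have h: "(s + 2 * real k) / 2 = s / 2 + real k" by (simp add: add_divide_distrib)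
    have e: "s + 2 * real k + 4 * p + 3 = s + 4 * p + 3 + 2 * real k" "s + 2 * real k + 2 * p + 3 = s + 2 * p + 3 + 2 * real k"
      "s / 2 + real k + p + 2 = s / 2 + p + 2 + real k" "s / 2 + real k + 2 * p + 2 = s / 2 + 2 * p + 2 + real k"
      "s / 2 + real k + p + 1 = s / 2 + p + 1 + real k" "s / 2 + real k + 1 = s / 2 + 1 + real k" by simp_all
    define G1 where "G1 = Gamma (s + 4 * p + 3 + 2 * real k) / Gamma (s + 2 * p + 3 + 2 * real k)"
    define G2 where "G2 = Gamma (s / 2 + p + 2 + real k) / Gamma (s / 2 + 2 * p + 2 + real k)"
    define G3 where "G3 = Gamma (s / 2 + p + 1 + real k) / Gamma (s / 2 + 1 + real k)"
    have L: "lim_moment p (s + 2 * real k) = ?C * G1 * G2 * G3"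
      unfolding lim_moment_def h rGamma_inverse_Gamma e G1_def G2_def G3_def
      by (simp only: divide_inverse power_mult_distrib)
    have "?C * ((G1 * X) * (G2 * a) * (G3 * b)) = ?C * G1 * G2 * G3 * X" if "a * b = 1" for a b X :: real
    proof -
      have "?C * ((G1 * X) * (G2 * a) * (G3 * b)) = ?C * G1 * G2 * G3 * X * (a * b)" by (simp only: mult_ac)
      then show ?thesis using that by simp
    qed
    from this[OF k] show ?case unfolding x L G1_def G2_def G3_def .
  qed
  ultimately have "(\<lambda>k. lim_moment p (s + 2 * real k) * (2 * real k) powr (- 2 * p)) \<longlonglongrightarrow> ?C * (1 * 1 * 1)"
    by (rule Lim_transform_eventually)
  then show ?thesis by simp
qed

text \<open>Lowering the argument by j costs a factor (2k)^(-j). Hence only the term i = j = 0 of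
  \<open>upper_moment\<close> survives for large k, and that term is
  \<open>lower_moment\<close>.\<close>

lemma Gamma_shifted_ratio_asymp:
  fixes p s :: real and j :: nat
  assumes "s > -1" "s + 2 * p + 1 - real j > 0"
  shows "(\<lambda>k. rGamma (s + 2 * real k + 1) * Gamma (s + 2 * real k + 2 * p + 1 - real j) * (2 * real k) powr (- 2 * p))
    \<longlonglongrightarrow> (if j = 0 then 1 else 0)"
proof -
  have "(\<lambda>k. (Gamma (s + 2 * p + 1 - real j + 2 * real k) / Gamma (s + 1 + 2 * real k) * (2 * real k) powr (s + 1 - (s + 2 * p + 1 - real j))) *
     inverse (2 * real k) ^ j) \<longlonglongrightarrow> 1 * 0 ^ j"
  proof (intro tendsto_mult tendsto_power Gamma_ratio_asymp_even)
    show "(\<lambda>k. inverse (2 * real k)) \<longlonglongrightarrow> 0" by real_asymp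
  qed (use assms in auto)
  moreover have "\<forall>\<^sub>F k in sequentially. (Gamma (s + 2 * p + 1 - real j + 2 * real k) / Gamma (s + 1 + 2 * real k) * (2 * real k) powr (s + 1 - (s + 2 * p + 1 - real j))) *
     inverse (2 * real k) ^ j = rGamma (s + 2 * real k + 1) * Gamma (s + 2 * real k + 2 * p + 1 - real j) * (2 * real k) powr (- 2 * p)"
    using eventually_gt_at_top[of 0]
  proof eventually_elim
    case (elim k)
    have "(2 * real k) powr real j = (2 * real k) ^ j" by (rule powr_realpow) (use elim in simp)
    then have "inverse (2 * real k) ^ j = (2 * real k) powr (- real j)"
      by (simp only: powr_minus power_inverse)
    then have "(2 * real k) powr (s + 1 - (s + 2 * p + 1 - real j)) * inverse (2 * real k) ^ j = (2 * real k) powr (- 2 * p)"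
      by (simp only: powr_add[symmetric]) simp
    moreover have e: "s + 1 + 2 * real k = s + 2 * real k + 1" "s + 2 * p + 1 - real j + 2 * real k = s + 2 * real k + 2 * p + 1 - real j"
      by simp_all
    ultimately show ?case
      unfolding e mult.assoc by (simp only:) (simp only: rGamma_inverse_Gamma divide_inverse mult_ac)
  qed
  ultimately have "(\<lambda>k. rGamma (s + 2 * real k + 1) * Gamma (s + 2 * real k + 2 * p + 1 - real j) * (2 * real k) powr (- 2 * p))
    \<longlonglongrightarrow> 1 * 0 ^ j"
    by (rule Lim_transform_eventually)
  then show ?thesis by (cases j) auto
qed

text \<open>Normalising by \<open>rGamma\<close> turns (s + 1) M(s) into the moment at s, which
  removes the zero at -1; relative to the term at s + 1, the later ones acquire s + 2 and (s + 2)(s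
  + 3).\<close>

lemma S_moment_recurrence:
  assumes "m \<ge> 1" "p > 0" "s > 4"
  shows "rec0 p s * S_moment p m s + rec1 p s * S_moment p m (s + 1)
     + rec2 p (real m) s * (s + 2) * S_moment p m (s + 2) + rec3 p (real m) s * (s + 2) * (s + 3) * S_moment p m (s + 3) = 0"
proof -
  define M where "M \<sigma> = integral {0..1} (\<lambda>t. Jacobi_weight (real m + p) \<sigma> t * (hyp2F1 (real m) (-p) (real m + p + 1) t)\<^sup>2)" for \<sigma>
  define K where "K = (S_factor p m)\<^sup>2 * rGamma (s + 2)"
  have r: "rGamma (s + 1) = (s + 1) * rGamma (s + 2)" "rGamma (s + 2) = (s + 2) * rGamma (s + 2 + 1)"
    "rGamma (s + 2) = (s + 2) * ((s + 3) * rGamma (s + 3 + 1))"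
    using rGamma_plus1[of "s + 1"] rGamma_plus1[of "s + 2"] rGamma_plus1[of "s + 3"]
    by (simp_all add: add_ac mult.assoc)
  have "S_moment p m s = K * ((s + 1) * M s)" "S_moment p m (s + 1) = K * M (s + 1)"
    "(s + 2) * S_moment p m (s + 2) = K * M (s + 2)"
    "(s + 2) * (s + 3) * S_moment p m (s + 3) = K * M (s + 3)"
    unfolding S_moment_def M_def[symmetric] K_def
       apply (subst r(1), simp only: mult_ac)
      apply (simp add: add.assoc)
     apply (subst r(2), simp only: mult_ac)
    apply (subst r(3), simp only: mult_ac)
    done
  then have "rec0 p s * S_moment p m s + rec1 p s * S_moment p m (s + 1)
     + rec2 p (real m) s * ((s + 2) * S_moment p m (s + 2)) + rec3 p (real m) s * ((s + 2) * (s + 3) * S_moment p m (s + 3))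
     = K * ((s + 1) * rec0 p s * M s + rec1 p s * M (s + 1) + rec2 p (real m) s * M (s + 2) + rec3 p (real m) s * M (s + 3))"
    by (simp only:) (simp add: algebra_simps)
  also have "\<dots> = 0" using moment_recurrence[OF assms] unfolding M_def by simp
  finally show ?thesis by (simp only: mult.assoc)
qed

section \<open>The limit\<close>

lemma S_moment_Bseq:
  assumes "p > 0" "p \<le> real N" "s > 4" "s > 2 * real N - 2 * p - 1"
  shows "Bseq (\<lambda>m. real m powr (s + 1) * S_moment p m s)"
proof -
  obtain l u L U where lu: "\<And>m. m \<ge> 1 \<Longrightarrow> l m \<le> real m powr (s + 1) * S_moment p m s"
    "\<And>m. m \<ge> 1 \<Longrightarrow> real m powr (s + 1) * S_moment p m s \<le> u m" "l \<longlonglongrightarrow> lower_moment p s" "u \<longlonglongrightarrow> upper_moment p N s"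
    using moment_squeeze[OF assms] by blast
  have "(\<lambda>m. \<bar>l m\<bar> + \<bar>u m\<bar>) \<longlonglongrightarrow> \<bar>lower_moment p s\<bar> + \<bar>upper_moment p N s\<bar>"
    by (intro tendsto_add tendsto_rabs lu)
  then have "Bseq (\<lambda>m. \<bar>l m\<bar> + \<bar>u m\<bar>)" by (intro convergent_imp_Bseq convergentI)
  moreover have "\<forall>\<^sub>F m in sequentially. norm (real m powr (s + 1) * S_moment p m s) \<le> norm (\<bar>l m\<bar> + \<bar>u m\<bar>)"
    using eventually_ge_at_top[of 1]
  proof eventually_elim
    case (elim m)
    from lu(1,2)[OF elim] show ?case unfolding real_norm_def by linarith
  qed
  ultimately show ?thesis by (rule Bseq_eventually_mono[rotated])
qed

lemma tendsto_diff_shift_even: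
  fixes r :: "real \<Rightarrow> nat \<Rightarrow> real"
  assumes "\<And>x. x > c \<Longrightarrow> (\<lambda>m. r x m - r (x + 2) m) \<longlonglongrightarrow> 0" "s > c"
  shows "(\<lambda>m. r s m - r (s + 2 * real k) m) \<longlonglongrightarrow> 0"
proof (induction k)
  case (Suc k)
  have "(\<lambda>m. r (s + 2 * real k) m - r (s + 2 * real k + 2) m) \<longlonglongrightarrow> 0"
    by (rule assms(1)) (use assms(2) in simp)
  from tendsto_add[OF Suc this] show ?case by (simp add: algebra_simps)
qed simp

text \<open>N = 2 p (that is n - 2 in the application) is an integer >= p, and with it 2 N - 2 p - 1
  = 2 p - 1; the single threshold s > 2 p + 4 then meets every requirement at s and at all larger
  arguments.\<close>

lemma S_moment_limit:
  fixes p s :: real and N :: nat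
  assumes p: "p > 0" and N: "2 * p = real N" and s: "s > 2 * p + 4"
  shows "(\<lambda>m. real m powr (s + 1) * S_moment p m s) \<longlonglongrightarrow> lim_moment p s"
proof -
  define a where "a \<sigma> m = real m powr (\<sigma> + 1) * S_moment p m \<sigma>" for \<sigma> m
  define r where "r \<sigma> m = a \<sigma> m / lim_moment p \<sigma>" for \<sigma> m
  have pN: "p \<le> real N" using N p by linarith
  have sz: "\<sigma> > 4" "\<sigma> > 2 * real N - 2 * p - 1" if "\<sigma> > 2 * p + 4" for \<sigma>
    using that p N by linarith+
  have step: "(\<lambda>m. r \<sigma> m - r (\<sigma> + 2) m) \<longlonglongrightarrow> 0" if \<sigma>: "\<sigma> > 2 * p + 4" for \<sigma>
  proof -
    have "(\<lambda>m. of_real (rec0 p \<sigma>) * (of_real (real m powr (\<sigma> + 1)) * (\<lambda>j m. S_moment p m (\<sigma> + real j)) 0 m)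
       - of_real ((\<sigma> + 3 + 2 * p) * (\<sigma> + 2)) * (of_real (real m powr (\<sigma> + 2 + 1)) * (\<lambda>j m. S_moment p m (\<sigma> + real j)) 2 m)) \<longlonglongrightarrow> (0::real)"
    proof (rule scaled_recurrence_limit)
      show "of_real (rec0 p \<sigma>) * S_moment p m (\<sigma> + real 0) + of_real (rec1 p \<sigma>) * S_moment p m (\<sigma> + real 1)
         + of_real (rec2 p (real m) \<sigma> * (\<sigma> + 2)) * S_moment p m (\<sigma> + real 2)
         + of_real (rec3 p (real m) \<sigma> * (\<sigma> + 2) * (\<sigma> + 3)) * S_moment p m (\<sigma> + real 3) = 0" if "m \<ge> 1" for m
        using S_moment_recurrence[OF that p sz(1)[OF \<sigma>]] by simp
      show "Bseq (\<lambda>m. of_real (real m powr (\<sigma> + real j + 1)) * S_moment p m (\<sigma> + real j))" for j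
        using S_moment_Bseq[OF p pN sz, of "\<sigma> + real j"] \<sigma> by simp
    qed
    then have D: "(\<lambda>m. rec0 p \<sigma> * a \<sigma> m - ((\<sigma> + 3 + 2 * p) * (\<sigma> + 2)) * a (\<sigma> + 2) m) \<longlonglongrightarrow> 0"
      by (simp add: a_def)
    \<comment> \<open>By the recurrence of the limit, c is at once \<open>rec0\<close> times the
      value at sigma and the other coefficient times the value at sigma + 2. Dividing by c therefore
      turns both terms into the normalised ratios r.\<close>
    define c where "c = rec0 p \<sigma> * lim_moment p \<sigma>"
    have L: "lim_moment p \<sigma> > 0" "lim_moment p (\<sigma> + 2) > 0" using p \<sigma> by (auto intro: lim_moment_pos)
    have r0: "rec0 p \<sigma> > 0" unfolding rec0_def using p \<sigma> by (intro mult_pos_pos) auto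
    have q0: "(\<sigma> + 3 + 2 * p) * (\<sigma> + 2) > 0" using p \<sigma> by (intro mult_pos_pos) auto
    have c: "c = (\<sigma> + 3 + 2 * p) * (\<sigma> + 2) * lim_moment p (\<sigma> + 2)"
      unfolding c_def by (rule lim_moment_recurrence) (use p \<sigma> in auto)
    have "(\<lambda>m. (rec0 p \<sigma> * a \<sigma> m - ((\<sigma> + 3 + 2 * p) * (\<sigma> + 2)) * a (\<sigma> + 2) m) / c) \<longlonglongrightarrow> 0 / c"
      by (intro tendsto_divide D tendsto_const) (use c_def L r0 in auto)
    moreover have "(rec0 p \<sigma> * a \<sigma> m - ((\<sigma> + 3 + 2 * p) * (\<sigma> + 2)) * a (\<sigma> + 2) m) / c = r \<sigma> m - r (\<sigma> + 2) m" for m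
    proof -
      have "rec0 p \<sigma> * a \<sigma> m / c = r \<sigma> m" unfolding c_def r_def using r0 by simp
      moreover have "((\<sigma> + 3 + 2 * p) * (\<sigma> + 2)) * a (\<sigma> + 2) m / c = r (\<sigma> + 2) m"
        unfolding c r_def using q0 by (metis less_irrefl mult_divide_mult_cancel_left)
      ultimately show ?thesis by (simp only: diff_divide_distrib)
    qed
    ultimately show ?thesis by simp
  qed
  define C where "C = (Gamma (p + 1) / Gamma (2 * p + 1))\<^sup>2"
  have C: "C > 0" unfolding C_def using p by (intro zero_less_power divide_pos_pos Gamma_real_pos) auto
  define lo where "lo = lower_moment p"
  define hi where "hi = upper_moment p N"
  let ?w = "\<lambda>k. (2 * real k) powr (- 2 * p)"
  have L: "(\<lambda>k. lim_moment p (s + 2 * real k) * ?w k) \<longlonglongrightarrow> C"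
    unfolding C_def by (rule lim_moment_asymp) (use p s in auto)
  have lo: "(\<lambda>k. lo (s + 2 * real k) * ?w k) \<longlonglongrightarrow> C"
  proof -
    have "(\<lambda>k. C * (rGamma (s + 2 * real k + 1) * Gamma (s + 2 * real k + 2 * p + 1 - real 0) * ?w k)) \<longlonglongrightarrow> C * (if 0 = (0::nat) then 1 else 0)"
      by (intro tendsto_mult tendsto_const Gamma_shifted_ratio_asymp) (use p s in auto)
    then show ?thesis by (simp add: lo_def lower_moment_def C_def mult_ac)
  qed
  have hi: "(\<lambda>k. hi (s + 2 * real k) * ?w k) \<longlonglongrightarrow> C"
  proof -
    let ?E = "\<lambda>i. real (N choose i) * pochhammer (p + 1) i"
    have "(\<lambda>k. C * (\<Sum>i\<le>N. \<Sum>j\<le>N. ?E i * ?E j * (rGamma (s + 2 * real k + 1) * Gamma (s + 2 * real k + 2 * p + 1 - real (i + j)) * ?w k)))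
      \<longlonglongrightarrow> C * (\<Sum>i\<le>N. \<Sum>j\<le>N. ?E i * ?E j * (if i + j = 0 then 1 else 0))"
      by (intro tendsto_mult tendsto_const tendsto_sum Gamma_shifted_ratio_asymp) (use p s N in auto)
    \<comment> \<open>Only i = j = 0 contributes, with binomial coefficient and Pochhammer symbol
      both 1.\<close>
    moreover have "(\<Sum>i\<le>N. \<Sum>j\<le>N. ?E i * ?E j * (if i + j = 0 then 1 else 0)) = 1"
    proof -
      have "(\<Sum>i\<le>N. \<Sum>j\<le>N. ?E i * ?E j * (if i + j = 0 then 1 else 0)) = (\<Sum>i\<le>N. \<Sum>j\<le>N. if j = 0 then (if i = 0 then 1 else 0) else 0)"
        by (intro sum.cong refl) auto
      also have "\<dots> = 1" by (simp add: sum.delta)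
      finally show ?thesis .
    qed
    moreover have "C * (\<Sum>i\<le>N. \<Sum>j\<le>N. ?E i * ?E j * (rGamma (s + 2 * real k + 1) * Gamma (s + 2 * real k + 2 * p + 1 - real (i + j)) * ?w k))
      = hi (s + 2 * real k) * ?w k" for k
      unfolding hi_def upper_moment_def C_def sum_distrib_left sum_distrib_right by (intro sum.cong refl) (simp only: mult_ac)
    ultimately show ?thesis by simp
  qed
  have ratio: "(\<lambda>k. f (s + 2 * real k) / lim_moment p (s + 2 * real k)) \<longlonglongrightarrow> 1"
    if "(\<lambda>k. f (s + 2 * real k) * ?w k) \<longlonglongrightarrow> C" for f
  proof -
    have "(\<lambda>k. (f (s + 2 * real k) * ?w k) / (lim_moment p (s + 2 * real k) * ?w k)) \<longlonglongrightarrow> C / C"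
      by (intro tendsto_divide that L) (use C in auto)
    then have "(\<lambda>k. (f (s + 2 * real k) * ?w k) / (lim_moment p (s + 2 * real k) * ?w k)) \<longlonglongrightarrow> 1"
      using C by simp
    moreover have "\<forall>\<^sub>F k in sequentially. (f (s + 2 * real k) * ?w k) / (lim_moment p (s + 2 * real k) * ?w k)
       = f (s + 2 * real k) / lim_moment p (s + 2 * real k)"
      using eventually_gt_at_top[of 0] by eventually_elim simp
    ultimately show ?thesis by (rule Lim_transform_eventually)
  qed
  have "r s \<longlonglongrightarrow> 1"
  proof (rule LIMSEQ_I)
    fix e :: real assume e: "e > 0"
    \<comment> \<open>The order of choices matters: k is fixed first, so that both bounding ratios
      lie within e/2 of 1, and only then m grows. The remaining e/2 pays for the passage from sigma
      back to s.\<close>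
    have "\<forall>\<^sub>F k in sequentially. lo (s + 2 * real k) / lim_moment p (s + 2 * real k) > 1 - e / 2"
      "\<forall>\<^sub>F k in sequentially. hi (s + 2 * real k) / lim_moment p (s + 2 * real k) < 1 + e / 2"
      using order_tendstoD(1)[OF ratio[OF lo], of "1 - e / 2"] order_tendstoD(2)[OF ratio[OF hi], of "1 + e / 2"] e by auto
    then have "\<forall>\<^sub>F k in sequentially. lo (s + 2 * real k) / lim_moment p (s + 2 * real k) > 1 - e / 2
      \<and> hi (s + 2 * real k) / lim_moment p (s + 2 * real k) < 1 + e / 2" by (rule eventually_conj)
    then obtain k where k: "lo (s + 2 * real k) / lim_moment p (s + 2 * real k) > 1 - e / 2"
      "hi (s + 2 * real k) / lim_moment p (s + 2 * real k) < 1 + e / 2"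
      by (auto simp: eventually_sequentially)
    define \<sigma> where "\<sigma> = s + 2 * real k"
    have \<sigma>: "\<sigma> > 2 * p + 4" using s by (simp add: \<sigma>_def)
    have Lp: "lim_moment p \<sigma> > 0" using p \<sigma> by (intro lim_moment_pos) auto
    obtain l u where lu: "\<And>m. m \<ge> 1 \<Longrightarrow> l m \<le> a \<sigma> m" "\<And>m. m \<ge> 1 \<Longrightarrow> a \<sigma> m \<le> u m" "l \<longlonglongrightarrow> lo \<sigma>" "u \<longlonglongrightarrow> hi \<sigma>"
      using moment_squeeze[OF p pN sz[OF \<sigma>]] unfolding a_def lo_def hi_def by blast
    have "(\<lambda>m. l m / lim_moment p \<sigma>) \<longlonglongrightarrow> lo \<sigma> / lim_moment p \<sigma>" "(\<lambda>m. u m / lim_moment p \<sigma>) \<longlonglongrightarrow> hi \<sigma> / lim_moment p \<sigma>"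
      using Lp by (auto intro!: tendsto_divide lu(3,4))
    then have "\<forall>\<^sub>F m in sequentially. l m / lim_moment p \<sigma> > 1 - e / 2" "\<forall>\<^sub>F m in sequentially. u m / lim_moment p \<sigma> < 1 + e / 2"
      using k unfolding \<sigma>_def[symmetric] by (auto dest: order_tendstoD)
    moreover have "\<forall>\<^sub>F m in sequentially. \<bar>r s m - r \<sigma> m\<bar> < e / 2"
    proof -
      have "(\<lambda>m. r s m - r \<sigma> m) \<longlonglongrightarrow> 0"
        unfolding \<sigma>_def by (rule tendsto_diff_shift_even[of "2 * p + 4" r s k, OF step s])
      then have "\<forall>\<^sub>F m in sequentially. dist (r s m - r \<sigma> m) 0 < e / 2"
        by (rule tendstoD) (use e in simp)
      then show ?thesis by (simp only: dist_real_def diff_0_right)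
    qed
    ultimately have "\<forall>\<^sub>F m in sequentially. norm (r s m - 1) < e"
      using eventually_ge_at_top[of 1]
    proof eventually_elim
      case (elim m)
      have "l m / lim_moment p \<sigma> \<le> r \<sigma> m" "r \<sigma> m \<le> u m / lim_moment p \<sigma>"
        unfolding r_def using lu(1,2)[OF elim(4)] Lp by (auto intro: divide_right_mono)
      then have "\<bar>r \<sigma> m - 1\<bar> < e / 2" using elim(1,2) by linarith
      then show ?case using elim(3) unfolding real_norm_def by linarith
    qed
    then show "\<exists>no. \<forall>n\<ge>no. norm (r s n - 1) < e" by (simp add: eventually_sequentially)
  qed
  moreover have "lim_moment p s > 0" using p s by (intro lim_moment_pos) auto
  ultimately have "(\<lambda>m. r s m * lim_moment p s) \<longlonglongrightarrow> 1 * lim_moment p s" by (intro tendsto_mult tendsto_const)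
  then show ?thesis using \<open>lim_moment p s > 0\<close> by (simp add: r_def a_def)
qed

section \<open>Complex s, continuation and descent to the left\<close>

definition S_cmoment :: "nat \<Rightarrow> nat \<Rightarrow> complex \<Rightarrow> complex" where
  "S_cmoment n m s = rGamma (s + 1) * integral {0..1} (\<lambda>t::real.
     of_real (1 - t) powr s * of_real (t powr (real m + real n / 2 - 1) * (S n m t)\<^sup>2))"

lemma I_integral_eq_S_cmoment:
  "I_integral n m s = Gamma (of_nat n / 2 + s + 1) / Gamma (of_nat n / 2) * S_cmoment n m s"
proof -
  have "of_real (t powr (real m + real n / 2 - 1)) * of_real (1 - t) powr s * of_real (S n m t ^ 2)
    = of_real (1 - t) powr s * complex_of_real (t powr (real m + real n / 2 - 1) * (S n m t)\<^sup>2)" for t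
    by simp
  then show ?thesis unfolding I_integral_def S_cmoment_def rGamma_inverse_Gamma
    by (simp only: divide_inverse inverse_mult_distrib mult.assoc)
qed

lemma S_eq:
  assumes "p = real n / 2 - 1"
  shows "S n m t = S_factor p m * hyp2F1 (real m) (-p) (real m + p + 1) t"
proof -
  have "2 * p + 1 = real n - 1" "p + 1 = real n / 2" "- p = 1 - real n / 2" "real m + p + 1 = real m + real n / 2"
    using assms by (simp_all add: field_simps)
  then show ?thesis unfolding S_def S_factor_def by (simp only:)
qed

lemma S_cmoment_of_real:
  assumes p: "p = real n / 2 - 1" and "n > 2" "m \<ge> 1" "s > 4"
  shows "S_cmoment n m (of_real s) = of_real (S_moment p m s)"
proof -
  let ?f = "\<lambda>t. Jacobi_weight (real m + p) s t * (hyp2F1 (real m) (-p) (real m + p + 1) t)\<^sup>2"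
  have "integral {0..1} (\<lambda>t::real. complex_of_real (1 - t) powr of_real s * of_real (t powr (real m + real n / 2 - 1) * (S n m t)\<^sup>2))
    = integral {0..1} (\<lambda>t. complex_of_real ((S_factor p m)\<^sup>2 * ?f t))"
  proof (rule integral_cong)
    fix t :: real assume "t \<in> {0..1}"
    then have w: "complex_of_real (1 - t) powr of_real s = of_real ((1 - t) powr s)"
      by (intro powr_of_real) auto
    have e: "real m + real n / 2 - 1 = real m + p" using p by simp
    show "complex_of_real (1 - t) powr of_real s * of_real (t powr (real m + real n / 2 - 1) * (S n m t)\<^sup>2)
       = complex_of_real ((S_factor p m)\<^sup>2 * ?f t)"
      unfolding S_eq[OF p] w e by (simp add: Jacobi_weight_def power_mult_distrib mult_ac)
  qed
  also have "\<dots> = of_real (integral {0..1} (\<lambda>t. (S_factor p m)\<^sup>2 * ?f t))"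
    by (rule integral_linear[OF integrable_on_mult_right[OF moment_integrable] bounded_linear_of_real, unfolded o_def])
       (use assms in auto)
  also have "integral {0..1} (\<lambda>t. (S_factor p m)\<^sup>2 * ?f t) = (S_factor p m)\<^sup>2 * integral {0..1} ?f"
    by (rule integral_mult_right)
  finally have X: "integral {0..1} (\<lambda>t::real. complex_of_real (1 - t) powr of_real s * of_real (t powr (real m + real n / 2 - 1) * (S n m t)\<^sup>2))
    = of_real ((S_factor p m)\<^sup>2 * integral {0..1} ?f)" .
  have R: "rGamma (complex_of_real s + 1) = of_real (rGamma (s + 1))"
    by (simp flip: rGamma_complex_of_real)
  show ?thesis unfolding S_cmoment_def X R S_moment_def
    by (simp only: of_real_mult[symmetric] mult_ac)
qed

text \<open>Because 0 <= F <= 1, the factor accompanying (1 - t)^s is bounded by the square of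
  \<open>S_factor\<close>. This reaches Re s > -1, well beyond the range s > 4 of the real
  recurrence.\<close>

lemma S_cmoment_holomorphic:
  assumes "n > 2" "m \<ge> 1"
  shows "S_cmoment n m holomorphic_on {s. Re s > -1}"
proof -
  define p where "p = real n / 2 - 1"
  have p: "p > 0" using assms by (simp add: p_def)
  let ?H = "hyp2F1 (real m) (-p) (real m + p + 1)"
  let ?h = "\<lambda>t. t powr (real m + real n / 2 - 1) * (S n m t)\<^sup>2"
  have h: "?h = (\<lambda>t. t powr (real m + p) * (S_factor p m * ?H t)\<^sup>2)"
    using S_eq[OF p_def] by (simp add: p_def add_diff_eq)
  have "isCont ?H t" if "t \<in> {0..<1}" for t
    by (rule isCont_hyp2F1) (use that p assms in auto)
  then have "continuous_on {0..<1} ?H" by (intro continuous_at_imp_continuous_on) auto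
  then have "continuous_on {0..<1} ?h"
    unfolding h by (intro continuous_on_mult continuous_on_power continuous_on_powr' continuous_intros) (use p in auto)
  moreover have "\<bar>?h t\<bar> \<le> (S_factor p m)\<^sup>2" if t: "0 \<le> t" "t < 1" for t
  proof -
    have "0 \<le> (1 - t) powr p" by simp
    also have "\<dots> \<le> ?H t" by (rule hyp2F1_ge_powr[OF assms(2) p t])
    finally have H: "0 \<le> ?H t" "?H t \<le> 1" using hyp2F1_le_1[OF assms(2) p t] by auto
    have "t powr (real m + p) \<le> 1 powr (real m + p)" using t p by (intro powr_mono2) auto
    moreover have "(?H t)\<^sup>2 \<le> 1" using H by (intro power_le_one) auto
    ultimately have "t powr (real m + p) * (?H t)\<^sup>2 \<le> 1" by (intro mult_le_one) auto
    then have "(S_factor p m)\<^sup>2 * (t powr (real m + p) * (?H t)\<^sup>2) \<le> (S_factor p m)\<^sup>2 * 1"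
      by (intro mult_left_mono) auto
    then show ?thesis unfolding fun_cong[OF h] by (simp add: power_mult_distrib mult_ac)
  qed
  ultimately have "(\<lambda>s. integral {0..1} (\<lambda>t. of_real (1 - t) powr s * of_real (?h t))) holomorphic_on {s. Re s > -1}"
    by (rule holomorphic_powr_moment)
  then show ?thesis unfolding S_cmoment_def[abs_def]
    by (intro holomorphic_on_mult holomorphic_intros)
qed

lemma of_real_rec:
  "rec0 (of_real p) (of_real s) = (of_real (rec0 p s) :: 'a :: {comm_ring_1, real_algebra_1})"
  "rec1 (of_real p) (of_real s) = (of_real (rec1 p s) :: 'a)"
  "rec2 (of_real p) (of_real m) (of_real s) = (of_real (rec2 p m s) :: 'a)"
  "rec3 (of_real p) (of_real m) (of_real s) = (of_real (rec3 p m s) :: 'a)"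
  unfolding rec0_def rec1_def rec2_def rec3_def by simp_all

lemma analytic_on_rec:
  "rec0 p analytic_on UNIV" "rec1 p analytic_on UNIV" "rec2 p m analytic_on UNIV" "rec3 p m analytic_on UNIV"
  unfolding rec0_def[abs_def] rec1_def[abs_def] rec2_def[abs_def] rec3_def[abs_def]
  by (intro analytic_intros)+

text \<open>Both sides are holomorphic on the half-plane, so the identity theorem spreads the
  recurrence from the real ray s > 4, of which 5 is an accumulation point.\<close>

lemma S_cmoment_recurrence:
  assumes n: "n > 2" and m: "m \<ge> 1" and p: "p = real n / 2 - 1" and s: "Re s > -1"
  shows "rec0 (of_real p) s * S_cmoment n m s + rec1 (of_real p) s * S_cmoment n m (s + 1)
     + rec2 (of_real p) (of_real (real m)) s * (s + 2) * S_cmoment n m (s + 2)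
     + rec3 (of_real p) (of_real (real m)) s * (s + 2) * (s + 3) * S_cmoment n m (s + 3) = 0"
    (is "?F s = 0")
proof (rule analytic_continuation[of ?F "{s. Re s > -1}" "complex_of_real ` {4<..}" 5])
  note hol = S_cmoment_holomorphic[OF n m]
  have sh: "(\<lambda>s. S_cmoment n m (s + a)) holomorphic_on {s. Re s > -1}" if "Re a \<ge> 0" for a
    by (rule holomorphic_on_compose_gen[of "\<lambda>s. s + a" _ "S_cmoment n m", unfolded o_def, OF _ hol])
       (use that in \<open>auto intro!: holomorphic_intros\<close>)
  have rec: "rec0 q holomorphic_on A" "rec1 q holomorphic_on A" "rec2 q r holomorphic_on A" "rec3 q r holomorphic_on A"
    for q r A
    by (rule analytic_imp_holomorphic, rule analytic_on_subset, rule analytic_on_rec, simp)+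
  have "(\<lambda>s. S_cmoment n m (s + 1)) holomorphic_on {s. Re s > -1}" "(\<lambda>s. S_cmoment n m (s + 2)) holomorphic_on {s. Re s > -1}"
    "(\<lambda>s. S_cmoment n m (s + 3)) holomorphic_on {s. Re s > -1}"
    by (rule sh; simp)+
  then show "?F holomorphic_on {s. Re s > -1}"
    by (intro holomorphic_on_add holomorphic_on_mult rec hol holomorphic_on_ident holomorphic_on_const)
  show "open {s. Re s > -1}" by (rule open_halfspace_Re_gt)
  show "connected {s. Re s > -1}" by (intro convex_connected convex_halfspace_Re_gt)
  show "5 islimpt complex_of_real ` {4<..}"
    unfolding islimpt_approachable
  proof (intro allI impI)
    fix e :: real assume "e > 0"
    have d: "complex_of_real (5 + e / 2) - 5 = of_real (e / 2)" by simp
    then have "dist (complex_of_real (5 + e / 2)) 5 = e / 2" unfolding dist_norm d norm_of_real using \<open>e > 0\<close> by simp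
    then show "\<exists>x'\<in>complex_of_real ` {4<..}. x' \<noteq> 5 \<and> dist x' 5 < e"
      using \<open>e > 0\<close> by (intro bexI[of _ "complex_of_real (5 + e / 2)"] imageI conjI) auto
  qed
  fix z assume "z \<in> complex_of_real ` {4<..}"
  then obtain x where x: "z = of_real x" "x > 4" by auto
  have e: "complex_of_real x + 1 = of_real (x + 1)" "complex_of_real x + 2 = of_real (x + 2)" "complex_of_real x + 3 = of_real (x + 3)"
    by simp_all
  have p0: "p > 0" using n p by simp
  have "?F z = of_real (rec0 p x * S_moment p m x + rec1 p x * S_moment p m (x + 1)
     + rec2 p (real m) x * (x + 2) * S_moment p m (x + 2) + rec3 p (real m) x * (x + 2) * (x + 3) * S_moment p m (x + 3))"
  proof -
    have "S_cmoment n m (of_real y) = of_real (S_moment p m y)" if "y \<in> {x, x + 1, x + 2, x + 3}" for y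
      by (rule S_cmoment_of_real[OF p n m]) (use that x(2) in auto)
    then have "S_cmoment n m (of_real x) = of_real (S_moment p m x)"
      "S_cmoment n m (of_real (x + 1)) = of_real (S_moment p m (x + 1))"
      "S_cmoment n m (of_real (x + 2)) = of_real (S_moment p m (x + 2))"
      "S_cmoment n m (of_real (x + 3)) = of_real (S_moment p m (x + 3))" by blast+
    then show ?thesis unfolding x(1) e of_real_rec by (simp only: of_real_add of_real_mult)
  qed
  also have "\<dots> = 0" by (simp only: S_moment_recurrence[OF m p0 x(2)] of_real_0)
  finally show "?F z = 0" .
qed (use s in auto)

text \<open>The exceptional set Z consists of the integers <= -n: the smallest set closed under s ->
  s - 1 that contains both zeros of \<open>rec0\<close>, namely -n and -(2n - 1). The poles of the
  Gamma prefactor are kept apart in the last clause.\<close>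

lemma I_continuation:
  assumes n: "n > 2" and m: "m \<ge> 1" and p: "p = real n / 2 - 1"
  obtains g where "\<And>s. Re s > -1 \<Longrightarrow> g s = S_cmoment n m s"
    "\<And>s. (\<And>k::nat. s \<noteq> - of_nat n - of_nat k) \<Longrightarrow>
       rec0 (of_real p) s * g s + rec1 (of_real p) s * g (s + 1)
       + rec2 (of_real p) (of_real (real m)) s * (s + 2) * g (s + 2)
       + rec3 (of_real p) (of_real (real m)) s * (s + 2) * (s + 3) * g (s + 3) = 0"
    "\<And>s. (\<And>k::nat. s \<noteq> - of_nat n - of_nat k) \<Longrightarrow> of_nat n / 2 + s + 1 \<notin> \<int>\<^sub>\<le>\<^sub>0 \<Longrightarrow>
       I n m s = Gamma (of_nat n / 2 + s + 1) / Gamma (of_nat n / 2) * g s"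
proof -
  define Z where "Z = {s::complex. \<exists>k::nat. s = - of_nat n - of_nat k}"
  have ReZ: "Re s < -1" if "s \<in> Z" for s using that n by (auto simp: Z_def)
  have rec0_Z: "s \<in> Z" if "rec0 (of_real p) s = 0" for s :: complex
  proof -
    \<comment> \<open>Writing 2n - 1 as n + (n - 1) exhibits the second zero as the element k = n -
      1 of Z.\<close>
    have e: "s + 2 + 2 * complex_of_real p = s + of_nat n" "s + 3 + 4 * complex_of_real p = s + of_nat n + of_nat (n - 1)"
      using n by (simp_all add: p of_nat_diff)
    have "s + of_nat n = 0 \<or> s + of_nat n + of_nat (n - 1) = 0"
      using that unfolding rec0_def e by (simp only: mult_eq_0_iff)
    then have "s = - of_nat n - of_nat 0 \<or> s = - of_nat n - of_nat (n - 1)"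
      by (rule disj_forward) (simp_all add: eq_diff_eq eq_neg_iff_add_eq_0 add_ac)
    then show ?thesis unfolding Z_def by blast
  qed
  have ZS: "s \<in> Z" if Suc: "s + 1 \<in> Z" for s
  proof -
    obtain k :: nat where "s + 1 = - of_nat n - of_nat k" using Suc by (auto simp: Z_def)
    then have "s = - of_nat n - of_nat (Suc k)" by (simp add: algebra_simps)
    then show ?thesis unfolding Z_def by blast
  qed
  obtain g where g: "g meromorphic_on UNIV" "\<And>s. Re s > -1 \<Longrightarrow> g s = S_cmoment n m s" "\<And>s. s \<notin> Z \<Longrightarrow> g analytic_on {s}"
    "\<And>s. s \<notin> Z \<Longrightarrow> rec0 (of_real p) s * g s + rec1 (of_real p) s * g (s + 1)
       + (rec2 (of_real p) (of_real (real m)) s * (s + 2)) * g (s + 2)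
       + (rec3 (of_real p) (of_real (real m)) s * (s + 2) * (s + 3)) * g (s + 3) = 0"
  proof (rule recurrence_continuation[OF S_cmoment_holomorphic[OF n m] analytic_on_rec(1,2) _ _ S_cmoment_recurrence[OF n m p] _ rec0_Z ZS])
    show "(\<lambda>s. rec2 (of_real p) (of_real (real m)) s * (s + 2)) analytic_on UNIV"
      "(\<lambda>s. rec3 (of_real p) (of_real (real m)) s * (s + 2) * (s + 3)) analytic_on UNIV"
      by (intro analytic_on_mult analytic_on_rec analytic_intros)+
    show "rec0 (of_real p) s \<noteq> 0" if "Re s > -1" for s using rec0_Z ReZ that by force
  qed blast+
  show ?thesis
  proof
    fix s :: complex assume s: "\<And>k::nat. s \<noteq> - of_nat n - of_nat k"
    then have sZ: "s \<notin> Z" by (auto simp: Z_def)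
    show "rec0 (of_real p) s * g s + rec1 (of_real p) s * g (s + 1)
       + rec2 (of_real p) (of_real (real m)) s * (s + 2) * g (s + 2)
       + rec3 (of_real p) (of_real (real m)) s * (s + 2) * (s + 3) * g (s + 3) = 0" by (rule g(4)[OF sZ])
    assume np: "of_nat n / 2 + s + 1 \<notin> \<int>\<^sub>\<le>\<^sub>0"
    show "I n m s = Gamma (of_nat n / 2 + s + 1) / Gamma (of_nat n / 2) * g s"
    proof (rule I_eq_continuation[OF g(1) _ _ g(3)[OF sZ] np])
      show "g analytic_on {s}" if "Re s > -1" for s using ReZ that by (intro g(3)) force
      show "Gamma (of_nat n / 2 + s + 1) / Gamma (of_nat n / 2) * g s = I_integral n m s" if "Re s > -1" for s
        unfolding I_integral_eq_S_cmoment g(2)[OF that] ..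
    qed
  qed (rule g(2))
qed

text \<open>Induction on l lowers the threshold for s by one. The hypothesis at s + 1, s + 2, s + 3
  bounds the scaled terms and gives the limit at s + 2; division by \<open>rec0\<close>, nonzero off
  the exceptional set, then yields the limit at s.\<close>

lemma continuation_limit:
  fixes G :: "nat \<Rightarrow> complex \<Rightarrow> complex" and s p :: real
  assumes n: "n > 2" and p: "p = real n / 2 - 1"
    and G: "\<And>m s. m \<ge> 1 \<Longrightarrow> Re s > -1 \<Longrightarrow> G m s = S_cmoment n m s"
    and rec: "\<And>m s. m \<ge> 1 \<Longrightarrow> (\<And>k::nat. s \<noteq> - of_nat n - of_nat k) \<Longrightarrow>
       rec0 (of_real p) s * G m s + rec1 (of_real p) s * G m (s + 1)
       + rec2 (of_real p) (of_real (real m)) s * (s + 2) * G m (s + 2)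
       + rec3 (of_real p) (of_real (real m)) s * (s + 2) * (s + 3) * G m (s + 3) = 0"
    and s: "\<And>k::nat. s \<noteq> - real n - real k"
  shows "(\<lambda>m. complex_of_real (real m powr (s + 1)) * G m (of_real s)) \<longlonglongrightarrow> of_real (lim_moment p s)"
proof -
  have p0: "p > 0" using n p by simp
  have "(\<lambda>m. complex_of_real (real m powr (s + 1)) * G m (of_real s)) \<longlonglongrightarrow> of_real (lim_moment p s)"
    if "s > 2 * p + 4 - real l" "\<And>k::nat. s \<noteq> - real n - real k" for s l
    using that
  proof (induction l arbitrary: s)
    case 0
    have "(\<lambda>m. complex_of_real (real m powr (s + 1) * S_moment p m s)) \<longlonglongrightarrow> of_real (lim_moment p s)"
      by (intro tendsto_of_real S_moment_limit[OF p0, of "n - 2"]) (use 0 n p in \<open>auto simp: of_nat_diff\<close>)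
    moreover have "\<forall>\<^sub>F m in sequentially. complex_of_real (real m powr (s + 1) * S_moment p m s)
        = complex_of_real (real m powr (s + 1)) * G m (of_real s)"
      using eventually_ge_at_top[of 1]
      by eventually_elim (use 0 p0 in \<open>simp add: G S_cmoment_of_real[OF p n]\<close>)
    ultimately show ?case by (rule Lim_transform_eventually)
  next
    case (Suc l)
    have s: "s \<noteq> - real n - real k" for k :: nat by (rule Suc.prems)
    have IH: "(\<lambda>m. complex_of_real (real m powr (s + real j + 1)) * G m (of_real (s + real j))) \<longlonglongrightarrow> of_real (lim_moment p (s + real j))"
      if "j \<ge> 1" for j
    proof (rule Suc.IH)
      show "s + real j > 2 * p + 4 - real l" using Suc.prems(1) that by simp
      show "s + real j \<noteq> - real n - real k" for k using s[of "k + j"] by (simp add: algebra_simps)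
    qed
    have "(\<lambda>m. of_real (rec0 p s) * (of_real (real m powr (s + 1)) * (\<lambda>j m. G m (of_real (s + real j))) 0 m)
       - of_real ((s + 3 + 2 * p) * (s + 2)) * (of_real (real m powr (s + 2 + 1)) * (\<lambda>j m. G m (of_real (s + real j))) 2 m)) \<longlonglongrightarrow> (0::complex)"
    proof (rule scaled_recurrence_limit)
      fix m :: nat assume m: "m \<ge> 1"
      have "complex_of_real s \<noteq> - of_nat n - of_nat k" for k :: nat
      proof
        assume "complex_of_real s = - of_nat n - of_nat k"
        then have "complex_of_real s = of_real (- real n - real k)" by simp
        then show False using s[of k] by (simp only: of_real_eq_iff)
      qed
      from rec[OF m this]
      show "of_real (rec0 p s) * G m (of_real (s + real 0)) + of_real (rec1 p s) * G m (of_real (s + real 1))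
         + of_real (rec2 p (real m) s * (s + 2)) * G m (of_real (s + real 2))
         + of_real (rec3 p (real m) s * (s + 2) * (s + 3)) * G m (of_real (s + real 3)) = 0"
        unfolding of_real_rec by simp
    next
      fix j :: nat assume "j \<in> {1, 2, 3}"
      then have "j \<ge> 1" by auto
      from IH[OF this] show "Bseq (\<lambda>m. of_real (real m powr (s + real j + 1)) * G m (of_real (s + real j)))"
        by (rule convergent_imp_Bseq[OF convergentI])
    qed
    from tendsto_add[OF this tendsto_mult[OF tendsto_const IH[of 2]], of "of_real ((s + 3 + 2 * p) * (s + 2))"]
    have "(\<lambda>m. of_real (rec0 p s) * (of_real (real m powr (s + 1)) * G m (of_real s))) \<longlonglongrightarrow>
       of_real ((s + 3 + 2 * p) * (s + 2) * lim_moment p (s + 2))" by simp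
    also have "(s + 3 + 2 * p) * (s + 2) * lim_moment p (s + 2) = rec0 p s * lim_moment p s"
      \<comment> \<open>The four conditions of \<open>lim_moment_recurrence\<close> exclude s = -n,
        -n - 2, -2n and -(2n - 1).\<close>
      using s[of 0] s[of 2] s[of n] s[of "n - 1"] n
      by (intro lim_moment_recurrence[symmetric]) (auto simp: p of_nat_diff field_simps)
    finally have *: "(\<lambda>m. of_real (rec0 p s) * (of_real (real m powr (s + 1)) * G m (of_real s))) \<longlonglongrightarrow>
       complex_of_real (rec0 p s * lim_moment p s)" .
    have "rec0 p s \<noteq> 0"
    proof -
      have e: "s + 2 + 2 * p = s + real n" "s + 3 + 4 * p = s + real n + real (n - 1)"
        using n by (simp_all add: p of_nat_diff)
      have "s + real n \<noteq> 0" using s[of 0] by auto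
      moreover have "s + real n + real (n - 1) \<noteq> 0" using s[of "n - 1"] by linarith
      ultimately show ?thesis unfolding rec0_def e by simp
    qed
    then show ?case
      using tendsto_divide[OF * tendsto_const[of "complex_of_real (rec0 p s)"]] by simp
  qed
  moreover have "s > 2 * p + 4 - real (nat \<lceil>2 * p + 5 - s\<rceil>)" by linarith
  ultimately show ?thesis using s by blast
qed

text \<open>The reciprocals of Gamma in the English formula appear as \<open>rGamma\<close>, which
  is 0 at the nonpositive integers, as the stated convention demands.\<close>

theorem proposition5p1:
  fixes n :: nat and s :: real
  assumes "n > 2"
    and "\<And>k::nat. s \<noteq> - (real n / 2) - real k"
    and "odd n \<Longrightarrow> s + real n - 1 \<ge> 0"
  shows "(\<lambda>m. complex_of_real (real m powr (s + 1)) * I n m (complex_of_real s)) \<longlonglongrightarrow>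
    complex_of_real (
      Gamma (real n / 2) * Gamma (s + 2 * real n - 1) * Gamma (1 + (s + real n) / 2) *
      Gamma (s + real n / 2 + 1) * Gamma ((s + real n) / 2) *
      rGamma (real n - 1) ^ 2 * rGamma (s + real n + 1) * rGamma (real n + s / 2) *
      rGamma (1 + s / 2))"
proof -
  define p where "p = real n / 2 - 1"
  \<comment> \<open>Collects the properties of one continuation in a single predicate, so that one
    choice provides a family G indexed by m.\<close>
  define Q where "Q m g \<longleftrightarrow> (\<forall>s. Re s > -1 \<longrightarrow> g s = S_cmoment n m s) \<and>
    (\<forall>s. (\<forall>k::nat. s \<noteq> - of_nat n - of_nat k) \<longrightarrow>
       rec0 (of_real p) s * g s + rec1 (of_real p) s * g (s + 1)
       + rec2 (of_real p) (of_real (real m)) s * (s + 2) * g (s + 2)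
       + rec3 (of_real p) (of_real (real m)) s * (s + 2) * (s + 3) * g (s + 3) = 0) \<and>
    (\<forall>s. (\<forall>k::nat. s \<noteq> - of_nat n - of_nat k) \<longrightarrow> of_nat n / 2 + s + 1 \<notin> \<int>\<^sub>\<le>\<^sub>0 \<longrightarrow>
       I n m s = Gamma (of_nat n / 2 + s + 1) / Gamma (of_nat n / 2) * g s)" for m g
  have "\<exists>g. Q m g" if "m \<ge> 1" for m
    using I_continuation[OF assms(1) that p_def] unfolding Q_def by metis
  then obtain G where G: "\<And>m. m \<ge> 1 \<Longrightarrow> Q m (G m)" by metis
  \<comment> \<open>For n = 2 j the value -n - k is -n/2 - (j + k), excluded by assumption; for odd
    n it lies below 1 - n.\<close>
  have s1: "s \<noteq> - real n - real k" for k :: nat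
  proof (cases "even n")
    case True
    then obtain j where j: "n = 2 * j" by (elim evenE)
    show ?thesis using assms(2)[of "j + k"] by (simp add: j)
  qed (use assms(3) in auto)
  have s2: "complex_of_real s \<noteq> - of_nat n - of_nat k" for k :: nat
  proof
    assume "complex_of_real s = - of_nat n - of_nat k"
    then have "complex_of_real s = of_real (- real n - real k)" by simp
    then show False using s1[of k] by (simp only: of_real_eq_iff)
  qed
  have arg: "of_nat n / 2 + complex_of_real s + 1 = of_real (s + real n / 2 + 1)" by simp
  have s3: "of_nat n / 2 + complex_of_real s + 1 \<notin> \<int>\<^sub>\<le>\<^sub>0"
  proof
    assume "of_nat n / 2 + complex_of_real s + 1 \<in> \<int>\<^sub>\<le>\<^sub>0"
    then obtain k :: nat where "complex_of_real (s + real n / 2 + 1) = of_real (- real k)"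
      unfolding arg by (auto elim!: nonpos_Ints_cases')
    then have "s + real n / 2 + 1 = - real k" by (simp only: of_real_eq_iff)
    \<comment> \<open>The argument carries an additional 1, so a pole at -k means s = -n/2 - (k +
      1).\<close>
    then show False using assms(2)[of "Suc k"] by simp
  qed
  define c where "c = Gamma (s + real n / 2 + 1) / Gamma (real n / 2)"
  have c: "Gamma (of_nat n / 2 + complex_of_real s + 1) / Gamma (of_nat n / 2) = of_real c"
    unfolding arg c_def by (simp add: Gamma_complex_of_real[symmetric])
  have "(\<lambda>m. complex_of_real (real m powr (s + 1)) * G m (of_real s)) \<longlonglongrightarrow> of_real (lim_moment p s)"
    by (rule continuation_limit[OF assms(1) p_def _ _ s1]) (use G in \<open>auto simp: Q_def\<close>)
  then have "(\<lambda>m. of_real c * (complex_of_real (real m powr (s + 1)) * G m (of_real s))) \<longlonglongrightarrow> of_real c * of_real (lim_moment p s)"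
    by (intro tendsto_mult tendsto_const)
  moreover have "\<forall>\<^sub>F m in sequentially. of_real c * (complex_of_real (real m powr (s + 1)) * G m (of_real s))
     = complex_of_real (real m powr (s + 1)) * I n m (complex_of_real s)"
    using eventually_ge_at_top[of 1]
  proof eventually_elim
    case (elim m)
    have "I n m (complex_of_real s) = of_real c * G m (of_real s)"
      using G[OF elim] s2 s3 unfolding Q_def c[symmetric] by blast
    then show ?case by (simp only: mult_ac)
  qed
  ultimately have "(\<lambda>m. complex_of_real (real m powr (s + 1)) * I n m (complex_of_real s)) \<longlonglongrightarrow> of_real c * of_real (lim_moment p s)"
    by (rule Lim_transform_eventually)
  also have "complex_of_real c * of_real (lim_moment p s) = of_real (c * lim_moment p s)" by simp
  also have "c * lim_moment p s = Gamma (real n / 2) * Gamma (s + 2 * real n - 1) * Gamma (1 + (s + real n) / 2) *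
      Gamma (s + real n / 2 + 1) * Gamma ((s + real n) / 2) *
      rGamma (real n - 1) ^ 2 * rGamma (s + real n + 1) * rGamma (real n + s / 2) *
      rGamma (1 + s / 2)"
  proof -
    have e: "p + 1 = real n / 2" "2 * p + 1 = real n - 1" "s + 4 * p + 3 = s + 2 * real n - 1" "s + 2 * p + 3 = s + real n + 1"
      "s / 2 + p + 2 = 1 + (s + real n) / 2" "s / 2 + 2 * p + 2 = real n + s / 2" "s / 2 + p + 1 = (s + real n) / 2" "s / 2 + 1 = 1 + s / 2"
      by (simp_all add: p_def field_simps)
    have "Gamma (real n / 2) > 0" using assms(1) by (intro Gamma_real_pos) auto
    then show ?thesis
      unfolding lim_moment_def e c_def by (simp add: power2_eq_square)
  qed
  finally show ?thesis .
qed

end
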